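(* Let $K$ be a field of characteristic $0$, let $m\ge 2$ and $k\ge 2$ be integers, and let $\tilde{\mathfrak n}_{m,k}$ be the free metabelian $k$-step nilpotent Lie algebra over $K$ in $m$ generators. Then $\tilde{\mathfrak n}_{m,k}$ admits an ad-invariant metric if and only if $(m,k)=(3,2)$ or $(m,k)=(2,3)$.
   Context: An ad-invariant metric on a Lie algebra $\mathfrak g$ over $K$ is a nondegenerate symmetric $K$-bilinear form $\langle\,,\,\rangle$ on $\mathfrak g$ (with values in $K$, no definiteness required) such that $\langle [x,y],z\rangle+\langle y,[x,z]\rangle=0$ for all $x,y,z\in\mathfrak g$. The central descending series of $\mathfrak g$ is $C^0(\mathfrak g)=\mathfrak g$, $C^r(\mathfrak g)=[\mathfrak g,C^{r-1}(\mathfrak g)]$ for $r\ge 1$. A Lie algebra $\mathfrak g$ is $k$-step nilpotent if $C^k(\mathfrak g)=0$ and $C^{k-1}(\mathfrak g)\neq 0$. Write $\mathfrak g'=[\mathfrak g,\mathfrak g]$ and $\mathfrak g''=[\mathfrak g',\mathfrak g']$. Let $\mathfrak f_m$ be the free Lie algebra over $K$ on $m$ generators. The free metabelian $k$-step nilpotent Lie algebra on $m$ generators is $\tilde{\mathfrak n}_{m,k}=\mathfrak f_m/(C^{k}(\mathfrak f_m)+\mathfrak f_m'')$. *)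

theory Defs
  imports "HOL-Algebra.Module" "HOL-Algebra.QuotRing"
begin

section \<open>Nonassociative algebras and Lie algebras\<close>

text \<open>
  The ground field is a type of class \<^class>\<open>field\<close>, turned into a ring record so that the
  library locale \<^locale>\<open>module\<close> applies. An algebra is a \<^typ>\<open>('k, 'a) module\<close> record in which
  \<open>mult\<close> is the bilinear product, i.e. the bracket in the case of a Lie algebra. The algebras
  considered have no unit, and the record field \<open>one\<close> carries no meaning.
\<close>

definition scalars :: "'k::field ring" where
  "scalars = \<lparr>carrier = UNIV, mult = (*), one = 1, zero = 0, add = (+)\<rparr>"

locale nonassoc_algebra = module scalars A for A :: "('k::field, 'a) module" (structure) +
  assumes prod_closed: "\<lbrakk>x \<in> carrier A; y \<in> carrier A\<rbrakk> \<Longrightarrow> x \<otimes> y \<in> carrier A"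
    and prod_add_left: "\<lbrakk>x \<in> carrier A; y \<in> carrier A; z \<in> carrier A\<rbrakk> \<Longrightarrow>
      (x \<oplus> y) \<otimes> z = (x \<otimes> z) \<oplus> (y \<otimes> z)"
    and prod_add_right: "\<lbrakk>x \<in> carrier A; y \<in> carrier A; z \<in> carrier A\<rbrakk> \<Longrightarrow>
      x \<otimes> (y \<oplus> z) = (x \<otimes> y) \<oplus> (x \<otimes> z)"
    and prod_smult_left: "\<lbrakk>x \<in> carrier A; y \<in> carrier A\<rbrakk> \<Longrightarrow> (c \<odot> x) \<otimes> y = c \<odot> (x \<otimes> y)"
    and prod_smult_right: "\<lbrakk>x \<in> carrier A; y \<in> carrier A\<rbrakk> \<Longrightarrow> x \<otimes> (c \<odot> y) = c \<odot> (x \<otimes> y)"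

locale lie_algebra = nonassoc_algebra L for L :: "('k::field, 'a) module" (structure) +
  assumes alternating: "x \<in> carrier L \<Longrightarrow> x \<otimes> x = \<zero>"
    and jacobi: "\<lbrakk>x \<in> carrier L; y \<in> carrier L; z \<in> carrier L\<rbrakk> \<Longrightarrow>
      (x \<otimes> (y \<otimes> z)) \<oplus> (y \<otimes> (z \<otimes> x)) \<oplus> (z \<otimes> (x \<otimes> y)) = \<zero>"

locale ad_invariant_metric = lie_algebra L for L :: "('k::field, 'a) module" (structure) +
  fixes form :: "'a \<Rightarrow> 'a \<Rightarrow> 'k"
  assumes form_add_left: "\<lbrakk>x \<in> carrier L; y \<in> carrier L; z \<in> carrier L\<rbrakk> \<Longrightarrow>
      form (x \<oplus> y) z = form x z + form y z"
    and form_add_right: "\<lbrakk>x \<in> carrier L; y \<in> carrier L; z \<in> carrier L\<rbrakk> \<Longrightarrow>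
      form x (y \<oplus> z) = form x y + form x z"
    and form_smult_left: "\<lbrakk>x \<in> carrier L; y \<in> carrier L\<rbrakk> \<Longrightarrow> form (c \<odot> x) y = c * form x y"
    and form_smult_right: "\<lbrakk>x \<in> carrier L; y \<in> carrier L\<rbrakk> \<Longrightarrow> form x (c \<odot> y) = c * form x y"
    and form_sym: "\<lbrakk>x \<in> carrier L; y \<in> carrier L\<rbrakk> \<Longrightarrow> form x y = form y x"
    and form_nondegenerate: "\<lbrakk>x \<in> carrier L; \<forall>y\<in>carrier L. form x y = 0\<rbrakk> \<Longrightarrow> x = \<zero>"
    and form_ad_invariant: "\<lbrakk>x \<in> carrier L; y \<in> carrier L; z \<in> carrier L\<rbrakk> \<Longrightarrow>
      form (x \<otimes> y) z + form y (x \<otimes> z) = 0"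


section \<open>Subspaces, ideals, quotients\<close>

definition lin_span :: "('k::field, 'a) module \<Rightarrow> 'a set \<Rightarrow> 'a set" where
  "lin_span A S = \<Inter>{H. submodule H scalars A \<and> S \<subseteq> H}"

definition alg_ideal :: "'a set \<Rightarrow> ('k::field, 'a) module \<Rightarrow> bool" where
  "alg_ideal I A \<longleftrightarrow> submodule I scalars A \<and>
     (\<forall>a\<in>carrier A. \<forall>x\<in>I. a \<otimes>\<^bsub>A\<^esub> x \<in> I \<and> x \<otimes>\<^bsub>A\<^esub> a \<in> I)"

definition gen_ideal :: "('k::field, 'a) module \<Rightarrow> 'a set \<Rightarrow> 'a set" where
  "gen_ideal A S = \<Inter>{I. alg_ideal I A \<and> S \<subseteq> I}"

text \<open>The counterpart of the library's \<^const>\<open>FactRing\<close>.\<close>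

definition quot_algebra :: "('k::field, 'a) module \<Rightarrow> 'a set \<Rightarrow> ('k, 'a set) module" where
  "quot_algebra A I =
    \<lparr>carrier = a_rcosets\<^bsub>A\<^esub> I, mult = rcoset_mult A I, one = I +>\<^bsub>A\<^esub> \<one>\<^bsub>A\<^esub>, zero = I,
     add = set_add A, smult = (\<lambda>c X. \<Union>x\<in>X. I +>\<^bsub>A\<^esub> (c \<odot>\<^bsub>A\<^esub> x))\<rparr>"

text \<open>\<open>[U, V]\<close> is the linear span of the brackets.\<close>

definition bracket_space :: "('k::field, 'a) module \<Rightarrow> 'a set \<Rightarrow> 'a set \<Rightarrow> 'a set" where
  "bracket_space L U V = lin_span L {x \<otimes>\<^bsub>L\<^esub> y |x y. x \<in> U \<and> y \<in> V}"

primrec central_series :: "('k::field, 'a) module \<Rightarrow> nat \<Rightarrow> 'a set" where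
  "central_series L 0 = carrier L"
| "central_series L (Suc r) = bracket_space L (carrier L) (central_series L r)"

definition derived :: "('k::field, 'a) module \<Rightarrow> 'a set" where
  "derived L = bracket_space L (carrier L) (carrier L)"

definition second_derived :: "('k::field, 'a) module \<Rightarrow> 'a set" where
  "second_derived L = bracket_space L (derived L) (derived L)"


section \<open>Free Lie algebras\<close>

text \<open>
  The free magma on a set of generators consists of the binary trees whose leaves are generators.
  The free nonassociative algebra is the space of finitely supported functions on the free magma;
  as every tree is a product of two trees in at most one way, the coefficient of a product at
  \<open>Node s t\<close> is the product of the coefficients at \<open>s\<close> and \<open>t\<close>. The free Lie algebra is its
  quotient by the ideal generated by the Lie algebra laws.
\<close>

datatype 'x magma = Leaf 'x | Node "'x magma" "'x magma"

primrec magma_prod :: "('x magma \<Rightarrow> 'k::field) \<Rightarrow> ('x magma \<Rightarrow> 'k) \<Rightarrow> 'x magma \<Rightarrow> 'k" where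
  "magma_prod f g (Leaf i) = 0"
| "magma_prod f g (Node s t) = f s * g t"

definition free_nonassoc :: "'x set \<Rightarrow> ('k::field, 'x magma \<Rightarrow> 'k) module" where
  "free_nonassoc X =
    \<lparr>carrier = {f. finite {t. f t \<noteq> 0} \<and> (\<forall>t. f t \<noteq> 0 \<longrightarrow> set_magma t \<subseteq> X)},
     mult = magma_prod, one = (\<lambda>t. 0), zero = (\<lambda>t. 0),
     add = (\<lambda>f g t. f t + g t), smult = (\<lambda>c f t. c * f t)\<rparr>"

definition lie_relations :: "('k::field, 'a) module \<Rightarrow> 'a set" where
  "lie_relations A = {x \<otimes>\<^bsub>A\<^esub> x |x. x \<in> carrier A} \<union>
     {(x \<otimes>\<^bsub>A\<^esub> (y \<otimes>\<^bsub>A\<^esub> z)) \<oplus>\<^bsub>A\<^esub> (y \<otimes>\<^bsub>A\<^esub> (z \<otimes>\<^bsub>A\<^esub> x)) \<oplus>\<^bsub>A\<^esub> (z \<otimes>\<^bsub>A\<^esub> (x \<otimes>\<^bsub>A\<^esub> y)) |x y z.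
        x \<in> carrier A \<and> y \<in> carrier A \<and> z \<in> carrier A}"

definition free_lie :: "'x set \<Rightarrow> ('k::field, ('x magma \<Rightarrow> 'k) set) module" where
  "free_lie X = quot_algebra (free_nonassoc X)
     (gen_ideal (free_nonassoc X) (lie_relations (free_nonassoc X)))"

definition free_metabelian_nilpotent ::
    "nat \<Rightarrow> nat \<Rightarrow> ('k::field, (nat magma \<Rightarrow> 'k) set set) module" where
  "free_metabelian_nilpotent m k =
    (let F = free_lie {..<m} in
       quot_algebra F (central_series F k <+>\<^bsub>F\<^esub> second_derived F))"


section \<open>The free metabelian nilpotent Lie algebra is a Lie algebra\<close>

lemma scalars_simps [simp]:
  "carrier scalars = UNIV" "mult scalars = (*)" "one scalars = 1"
  "zero scalars = 0" "add scalars = (+)"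
  by (simp_all add: scalars_def)

lemma cring_scalars: "cring (scalars :: 'k::field ring)"
proof (rule cringI)
  show "abelian_group (scalars :: 'k ring)"
  proof (rule abelian_groupI)
    fix x :: 'k
    show "\<exists>y\<in>carrier scalars. y \<oplus>\<^bsub>scalars\<^esub> x = \<zero>\<^bsub>scalars\<^esub>"
      by (rule bexI[of _ "- x"]) auto
  qed (auto simp: algebra_simps)
  show "comm_monoid (scalars :: 'k ring)"
    by (rule comm_monoidI) auto
qed (auto simp: algebra_simps)

lemma alg_idealD:
  assumes "alg_ideal I A"
  shows "submodule I scalars A"
    and "\<And>a x. \<lbrakk>a \<in> carrier A; x \<in> I\<rbrakk> \<Longrightarrow> a \<otimes>\<^bsub>A\<^esub> x \<in> I"
    and "\<And>a x. \<lbrakk>a \<in> carrier A; x \<in> I\<rbrakk> \<Longrightarrow> x \<otimes>\<^bsub>A\<^esub> a \<in> I"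
  using assms by (auto simp: alg_ideal_def)

context nonassoc_algebra
begin

lemma smult_laws [simp]:
  "x \<in> carrier A \<Longrightarrow> c \<odot> x \<in> carrier A"
  "x \<in> carrier A \<Longrightarrow> 1 \<odot> x = x"
  "x \<in> carrier A \<Longrightarrow> 0 \<odot> x = \<zero>"
  "c \<odot> \<zero> = \<zero>"
  using smult_closed[of c x] smult_one[of x] smult_l_null[of x] smult_r_null[of c] by simp_all

lemma smult_distribs:
  "x \<in> carrier A \<Longrightarrow> (a + b) \<odot> x = a \<odot> x \<oplus> b \<odot> x"
  "\<lbrakk>x \<in> carrier A; y \<in> carrier A\<rbrakk> \<Longrightarrow> c \<odot> (x \<oplus> y) = c \<odot> x \<oplus> c \<odot> y"
  "x \<in> carrier A \<Longrightarrow> (a * b) \<odot> x = a \<odot> (b \<odot> x)"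
  using smult_l_distr[of a b x] smult_r_distr[of c x y] smult_assoc1[of a b x] by simp_all

lemma neg_eq_smult:
  assumes "x \<in> carrier A" shows "\<ominus> x = (-1) \<odot> x"
proof -
  have "(-1) \<odot> x \<oplus> x = \<zero>" using smult_distribs(1)[OF assms, of "-1" 1] assms by simp
  then show ?thesis using assms by (simp add: M.minus_equality)
qed

lemma submodule_iff:
  "submodule H scalars A \<longleftrightarrow> H \<subseteq> carrier A \<and> \<zero> \<in> H \<and>
     (\<forall>a\<in>H. \<forall>b\<in>H. a \<oplus> b \<in> H) \<and> (\<forall>c. \<forall>a\<in>H. c \<odot> a \<in> H)" (is "_ \<longleftrightarrow> ?R")
proof
  assume H: "submodule H scalars A"
  then interpret H: submodule H scalars A .
  show ?R using H.subset H.one_closed H.m_closed H.smult_closed by auto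
next
  assume R: ?R
  show "submodule H scalars A"
  proof (rule submoduleI)
    fix a assume a: "a \<in> H"
    then have "\<ominus> a = (-1) \<odot> a" using R neg_eq_smult by blast
    then show "\<ominus> a \<in> H" using R a by auto
  qed (use R in auto)
qed

lemma submodule_Inter:
  assumes "\<And>H. H \<in> HH \<Longrightarrow> submodule H scalars A" "HH \<noteq> {}"
  shows "submodule (\<Inter>HH) scalars A"
proof -
  obtain H0 where "H0 \<in> HH" using assms(2) by auto
  then show ?thesis
    using assms(1) unfolding submodule_iff by (intro conjI ballI allI InterI) (blast | simp)+
qed

lemma carrier_ideal: "alg_ideal (carrier A) A"
  by (simp add: alg_ideal_def carrier_is_submodule prod_closed)

lemma lin_span_submodule: "S \<subseteq> carrier A \<Longrightarrow> submodule (lin_span A S) scalars A"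
  unfolding lin_span_def by (rule submodule_Inter) (auto intro: carrier_is_submodule)

lemma lin_span_superset: "S \<subseteq> lin_span A S"
  by (auto simp: lin_span_def)

lemma lin_span_least: "\<lbrakk>submodule H scalars A; S \<subseteq> H\<rbrakk> \<Longrightarrow> lin_span A S \<subseteq> H"
  by (auto simp: lin_span_def)

lemma gen_ideal_ideal:
  assumes "S \<subseteq> carrier A" shows "alg_ideal (gen_ideal A S) A"
proof -
  have "submodule (gen_ideal A S) scalars A"
    unfolding gen_ideal_def
    by (rule submodule_Inter) (use assms carrier_ideal in \<open>auto simp: alg_ideal_def\<close>)
  then show ?thesis by (auto simp: alg_ideal_def gen_ideal_def)
qed

lemma gen_ideal_superset: "S \<subseteq> gen_ideal A S"
  by (auto simp: gen_ideal_def)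

lemma ideal_sum:
  assumes I: "alg_ideal I A" and J: "alg_ideal J A"
  shows "alg_ideal (set_add A I J) A"
proof -
  have sI: "I \<subseteq> carrier A" and sJ: "J \<subseteq> carrier A"
    using alg_idealD(1)[OF I] alg_idealD(1)[OF J] by (auto simp: submodule_iff)
  have eq: "set_add A I J = {a \<oplus> b |a b. a \<in> I \<and> b \<in> J}"
    by (auto simp: set_add_def')
  have "submodule (set_add A I J) scalars A"
    unfolding submodule_iff
  proof (intro conjI ballI allI)
    show "set_add A I J \<subseteq> carrier A" using sI sJ by (auto simp: eq)
    show "\<zero> \<in> set_add A I J"
      using alg_idealD(1)[OF I] alg_idealD(1)[OF J] M.zero_closed
      unfolding eq submodule_iff by (auto intro!: exI[of _ \<zero>])
  next
    fix u v assume "u \<in> set_add A I J" "v \<in> set_add A I J"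
    then obtain a b c d where *: "u = a \<oplus> b" "v = c \<oplus> d" "a \<in> I" "b \<in> J" "c \<in> I" "d \<in> J"
      by (auto simp: eq)
    then have "u \<oplus> v = (a \<oplus> c) \<oplus> (b \<oplus> d)"
      using sI sJ by (simp add: M.a_ac subset_iff)
    moreover have "a \<oplus> c \<in> I" "b \<oplus> d \<in> J"
      using * alg_idealD(1)[OF I] alg_idealD(1)[OF J] by (auto simp: submodule_iff)
    ultimately show "u \<oplus> v \<in> set_add A I J" unfolding eq by blast
  next
    fix c u assume "u \<in> set_add A I J"
    then obtain a b where *: "u = a \<oplus> b" "a \<in> I" "b \<in> J" by (auto simp: eq)
    then have "c \<odot> u = c \<odot> a \<oplus> c \<odot> b" using sI sJ smult_r_distr[of c a b] by auto
    moreover have "c \<odot> a \<in> I" "c \<odot> b \<in> J"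
      using * alg_idealD(1)[OF I] alg_idealD(1)[OF J] by (auto simp: submodule_iff)
    ultimately show "c \<odot> u \<in> set_add A I J" unfolding eq by blast
  qed
  moreover have "a \<otimes> u \<in> set_add A I J \<and> u \<otimes> a \<in> set_add A I J" if a: "a \<in> carrier A" and "u \<in> set_add A I J" for a u
  proof -
    from that(2) obtain b c where *: "u = b \<oplus> c" "b \<in> I" "c \<in> J" by (auto simp: eq)
    have "a \<otimes> u = a \<otimes> b \<oplus> a \<otimes> c" "u \<otimes> a = b \<otimes> a \<oplus> c \<otimes> a"
      using * a sI sJ by (auto intro!: prod_add_left prod_add_right)
    then show ?thesis
      unfolding eq using * a alg_idealD[OF I] alg_idealD[OF J] by blast
  qed
  ultimately show ?thesis by (simp add: alg_ideal_def)
qed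

end

locale alg_quotient = nonassoc_algebra A for A :: "('k::field, 'a) module" (structure) +
  fixes I
  assumes I: "alg_ideal I A"
begin

abbreviation "Q \<equiv> quot_algebra A I"

sublocale I: abelian_subgroup I A
proof (rule abelian_subgroupI3)
  show "additive_subgroup I A"
    using alg_idealD(1)[OF I] by (simp add: additive_subgroup_def submodule_def)
qed (rule M.abelian_group_axioms)

lemma cosetE:
  assumes "X \<in> carrier Q" obtains x where "x \<in> carrier A" "X = I +> x"
  using assms by (auto simp: quot_algebra_def A_RCOSETS_def')

lemma coset_closed [simp]: "x \<in> carrier A \<Longrightarrow> I +> x \<in> carrier Q"
  by (auto simp: quot_algebra_def A_RCOSETS_def')

lemma coset_mem: "y \<in> I +> x \<longleftrightarrow> (\<exists>h\<in>I. y = h \<oplus> x)"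
  by (auto simp: a_r_coset_def r_coset_def)

lemma coset_absorb: "\<lbrakk>h \<in> I; x \<in> carrier A\<rbrakk> \<Longrightarrow> I +> (h \<oplus> x) = I +> x"
  using M.a_coset_add_assoc[of I h x] M.a_coset_join2[of h I] I.a_subset I.a_subgroup by auto

lemma coset_zero [simp]: "h \<in> I \<Longrightarrow> I +> h = I"
  using coset_absorb[of h \<zero>] I.a_subset by auto

lemma quot_zero: "\<zero>\<^bsub>Q\<^esub> = I"
  by (simp add: quot_algebra_def)

lemma quot_add: "\<lbrakk>x \<in> carrier A; y \<in> carrier A\<rbrakk> \<Longrightarrow> (I +> x) \<oplus>\<^bsub>Q\<^esub> (I +> y) = I +> (x \<oplus> y)"
  by (simp add: quot_algebra_def I.a_rcos_sum)

lemma quot_smult: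
  assumes "x \<in> carrier A" shows "c \<odot>\<^bsub>Q\<^esub> (I +> x) = I +> (c \<odot> x)"
proof -
  have "I +> (c \<odot> y) = I +> (c \<odot> x)" if y: "y \<in> I +> x" for y
  proof -
    obtain h where h: "h \<in> I" "y = h \<oplus> x" using y by (auto simp: coset_mem)
    then have "c \<odot> y = c \<odot> h \<oplus> c \<odot> x" using assms I.a_subset smult_r_distr[of c h x] by auto
    moreover have "c \<odot> h \<in> I" using alg_idealD(1)[OF I] h by (auto simp: submodule_iff)
    ultimately show ?thesis using assms smult_closed[of c x] by (simp add: coset_absorb)
  qed
  then have "(\<Union>y\<in>I +> x. I +> (c \<odot> y)) = (\<Union>y\<in>I +> x. I +> (c \<odot> x))"
    by (intro SUP_cong refl) blast
  also have "\<dots> = I +> (c \<odot> x)" using I.a_rcos_self[OF assms] by blast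
  finally show ?thesis by (simp add: quot_algebra_def)
qed

lemma quot_mult:
  assumes "x \<in> carrier A" "y \<in> carrier A" shows "(I +> x) \<otimes>\<^bsub>Q\<^esub> (I +> y) = I +> (x \<otimes> y)"
proof -
  have "I +> (u \<otimes> v) = I +> (x \<otimes> y)" if uv: "u \<in> I +> x" "v \<in> I +> y" for u v
  proof -
    obtain h k where h: "h \<in> I" "u = h \<oplus> x" "k \<in> I" "v = k \<oplus> y"
      using uv by (auto simp: coset_mem)
    then have c: "h \<in> carrier A" "k \<in> carrier A" "u \<in> carrier A" "v \<in> carrier A"
      using assms I.a_subset by auto
    have "u \<otimes> v = h \<otimes> v \<oplus> x \<otimes> v"
      unfolding h(2) using c assms by (intro prod_add_left)
    moreover have "x \<otimes> v = x \<otimes> k \<oplus> x \<otimes> y"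
      unfolding h(4) using c assms by (intro prod_add_right)
    ultimately have "u \<otimes> v = h \<otimes> v \<oplus> (x \<otimes> k \<oplus> x \<otimes> y)" by simp
    moreover have "h \<otimes> v \<in> I" "x \<otimes> k \<in> I" using alg_idealD[OF I] h c assms by auto
    ultimately show ?thesis using assms prod_closed c by (simp add: coset_absorb)
  qed
  then have "(\<Union>u\<in>I +> x. \<Union>v\<in>I +> y. I +> (u \<otimes> v)) = (\<Union>u\<in>I +> x. \<Union>v\<in>I +> y. I +> (x \<otimes> y))"
    by (intro SUP_cong refl) blast
  also have "\<dots> = I +> (x \<otimes> y)"
    using I.a_rcos_self[OF assms(1)] I.a_rcos_self[OF assms(2)] by blast
  finally show ?thesis by (simp add: quot_algebra_def rcoset_mult_def)
qed

lemmas quot_ops = quot_zero quot_add quot_smult quot_mult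

lemma quot_forall: "(\<forall>X\<in>carrier Q. P X) \<longleftrightarrow> (\<forall>x\<in>carrier A. P (I +> x))"
  by (auto simp: quot_algebra_def A_RCOSETS_def')

lemma abelian_group_quot: "abelian_group Q"
proof (rule abelian_groupI)
  show z: "\<zero>\<^bsub>Q\<^esub> \<in> carrier Q" using coset_closed[of \<zero>] by (simp add: quot_zero)
  have "\<forall>X\<in>carrier Q. \<forall>Y\<in>carrier Q. X \<oplus>\<^bsub>Q\<^esub> Y \<in> carrier Q"
    "\<forall>X\<in>carrier Q. \<forall>Y\<in>carrier Q. X \<oplus>\<^bsub>Q\<^esub> Y = Y \<oplus>\<^bsub>Q\<^esub> X"
    "\<forall>X\<in>carrier Q. \<forall>Y\<in>carrier Q. \<forall>Z\<in>carrier Q. (X \<oplus>\<^bsub>Q\<^esub> Y) \<oplus>\<^bsub>Q\<^esub> Z = X \<oplus>\<^bsub>Q\<^esub> (Y \<oplus>\<^bsub>Q\<^esub> Z)"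
    unfolding quot_forall by (simp_all add: quot_add M.a_ac)
  then show "X \<oplus>\<^bsub>Q\<^esub> Y \<in> carrier Q" "X \<oplus>\<^bsub>Q\<^esub> Y = Y \<oplus>\<^bsub>Q\<^esub> X"
    and "Z \<in> carrier Q \<Longrightarrow> (X \<oplus>\<^bsub>Q\<^esub> Y) \<oplus>\<^bsub>Q\<^esub> Z = X \<oplus>\<^bsub>Q\<^esub> (Y \<oplus>\<^bsub>Q\<^esub> Z)"
    if "X \<in> carrier Q" "Y \<in> carrier Q" for X Y Z
    using that by blast+
next
  fix X assume "X \<in> carrier Q"
  then obtain x where "x \<in> carrier A" "X = I +> x" by (rule cosetE)
  then show "\<exists>Y\<in>carrier Q. Y \<oplus>\<^bsub>Q\<^esub> X = \<zero>\<^bsub>Q\<^esub>"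
    by (intro bexI[of _ "I +> (\<ominus> x)"]) (simp_all add: quot_ops M.l_neg)
  show "\<zero>\<^bsub>Q\<^esub> \<oplus>\<^bsub>Q\<^esub> X = X"
    using quot_add[of \<zero> x] \<open>x \<in> _\<close> \<open>X = _\<close> by (simp add: quot_zero)
qed

lemma module_quot: "module scalars Q"
proof -
  have "\<forall>X\<in>carrier Q. \<forall>c. c \<odot>\<^bsub>Q\<^esub> X \<in> carrier Q"
    "\<forall>X\<in>carrier Q. \<forall>a b. (a + b) \<odot>\<^bsub>Q\<^esub> X = (a \<odot>\<^bsub>Q\<^esub> X) \<oplus>\<^bsub>Q\<^esub> (b \<odot>\<^bsub>Q\<^esub> X)"
    "\<forall>X\<in>carrier Q. \<forall>Y\<in>carrier Q. \<forall>c. c \<odot>\<^bsub>Q\<^esub> (X \<oplus>\<^bsub>Q\<^esub> Y) = (c \<odot>\<^bsub>Q\<^esub> X) \<oplus>\<^bsub>Q\<^esub> (c \<odot>\<^bsub>Q\<^esub> Y)"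
    "\<forall>X\<in>carrier Q. \<forall>a b. (a * b) \<odot>\<^bsub>Q\<^esub> X = a \<odot>\<^bsub>Q\<^esub> (b \<odot>\<^bsub>Q\<^esub> X)"
    "\<forall>X\<in>carrier Q. 1 \<odot>\<^bsub>Q\<^esub> X = X"
    unfolding quot_forall by (simp_all add: quot_add quot_smult smult_distribs)
  then show ?thesis
    by (intro moduleI[OF cring_scalars abelian_group_quot]) simp_all
qed

lemma nonassoc_algebra_quot: "nonassoc_algebra Q"
proof -
  have "\<forall>X\<in>carrier Q. \<forall>Y\<in>carrier Q. X \<otimes>\<^bsub>Q\<^esub> Y \<in> carrier Q"
    "\<forall>X\<in>carrier Q. \<forall>Y\<in>carrier Q. \<forall>Z\<in>carrier Q. (X \<oplus>\<^bsub>Q\<^esub> Y) \<otimes>\<^bsub>Q\<^esub> Z = (X \<otimes>\<^bsub>Q\<^esub> Z) \<oplus>\<^bsub>Q\<^esub> (Y \<otimes>\<^bsub>Q\<^esub> Z)"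
    "\<forall>X\<in>carrier Q. \<forall>Y\<in>carrier Q. \<forall>Z\<in>carrier Q. X \<otimes>\<^bsub>Q\<^esub> (Y \<oplus>\<^bsub>Q\<^esub> Z) = (X \<otimes>\<^bsub>Q\<^esub> Y) \<oplus>\<^bsub>Q\<^esub> (X \<otimes>\<^bsub>Q\<^esub> Z)"
    "\<forall>X\<in>carrier Q. \<forall>Y\<in>carrier Q. \<forall>c. (c \<odot>\<^bsub>Q\<^esub> X) \<otimes>\<^bsub>Q\<^esub> Y = c \<odot>\<^bsub>Q\<^esub> (X \<otimes>\<^bsub>Q\<^esub> Y)"
    "\<forall>X\<in>carrier Q. \<forall>Y\<in>carrier Q. \<forall>c. X \<otimes>\<^bsub>Q\<^esub> (c \<odot>\<^bsub>Q\<^esub> Y) = c \<odot>\<^bsub>Q\<^esub> (X \<otimes>\<^bsub>Q\<^esub> Y)"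
    unfolding quot_forall
    by (simp_all add: quot_add quot_smult quot_mult prod_closed prod_add_left prod_add_right
        prod_smult_left prod_smult_right)
  then show ?thesis
    by (intro nonassoc_algebra.intro nonassoc_algebra_axioms.intro module_quot) simp_all
qed

lemma lie_algebra_quot:
  assumes "lie_relations A \<subseteq> I" shows "lie_algebra Q"
proof (intro lie_algebra.intro nonassoc_algebra_quot lie_algebra_axioms.intro)
  fix X assume "X \<in> carrier Q"
  then obtain x where "x \<in> carrier A" "X = I +> x" by (rule cosetE)
  moreover from this have "x \<otimes> x \<in> I" using assms by (auto simp: lie_relations_def)
  ultimately show "X \<otimes>\<^bsub>Q\<^esub> X = \<zero>\<^bsub>Q\<^esub>" by (simp add: quot_ops)
next
  fix X Y Z assume "X \<in> carrier Q" "Y \<in> carrier Q" "Z \<in> carrier Q"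
  then obtain x y z where *: "x \<in> carrier A" "y \<in> carrier A" "z \<in> carrier A"
      "X = I +> x" "Y = I +> y" "Z = I +> z" by (meson cosetE)
  then have "(x \<otimes> (y \<otimes> z)) \<oplus> (y \<otimes> (z \<otimes> x)) \<oplus> (z \<otimes> (x \<otimes> y)) \<in> I"
    using assms unfolding lie_relations_def by blast
  with * show "(X \<otimes>\<^bsub>Q\<^esub> (Y \<otimes>\<^bsub>Q\<^esub> Z)) \<oplus>\<^bsub>Q\<^esub> (Y \<otimes>\<^bsub>Q\<^esub> (Z \<otimes>\<^bsub>Q\<^esub> X)) \<oplus>\<^bsub>Q\<^esub> (Z \<otimes>\<^bsub>Q\<^esub> (X \<otimes>\<^bsub>Q\<^esub> Y)) = \<zero>\<^bsub>Q\<^esub>"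
    by (simp add: quot_ops prod_closed)
qed

end

context lie_algebra
begin

lemma prod_zero_left: "x \<in> carrier L \<Longrightarrow> \<zero> \<otimes> x = \<zero>"
  using prod_smult_left[of \<zero> x 0] prod_closed[of \<zero> x] by simp

lemma prod_zero_right: "x \<in> carrier L \<Longrightarrow> x \<otimes> \<zero> = \<zero>"
  using prod_smult_right[of x \<zero> 0] prod_closed[of x \<zero>] by simp

lemma skew:
  assumes "x \<in> carrier L" "y \<in> carrier L" shows "x \<otimes> y = (-1) \<odot> (y \<otimes> x)"
proof -
  have "\<zero> = (x \<oplus> y) \<otimes> (x \<oplus> y)" using assms alternating[of "x \<oplus> y"] by simp
  also have "\<dots> = x \<otimes> (x \<oplus> y) \<oplus> y \<otimes> (x \<oplus> y)"
    using assms by (intro prod_add_left) auto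
  also have "\<dots> = x \<otimes> y \<oplus> y \<otimes> x"
    using assms prod_closed[of x y] prod_closed[of y x]
    by (simp add: prod_add_right alternating)
  finally have "x \<otimes> y = \<ominus> (y \<otimes> x)"
    using assms prod_closed[of x y] prod_closed[of y x] M.minus_equality[of "x \<otimes> y" "y \<otimes> x"] by simp
  then show ?thesis using neg_eq_smult[of "y \<otimes> x"] prod_closed assms by simp
qed

lemma ideal_if_left:
  assumes "submodule I scalars L" "\<And>a x. \<lbrakk>a \<in> carrier L; x \<in> I\<rbrakk> \<Longrightarrow> a \<otimes> x \<in> I"
  shows "alg_ideal I L"
proof -
  have "x \<otimes> a \<in> I" if "a \<in> carrier L" "x \<in> I" for a x
    using assms skew[of x a] that by (auto simp: submodule_iff)
  with assms show ?thesis by (simp add: alg_ideal_def)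
qed

lemma ideal_bracket:
  assumes I: "alg_ideal I L" and J: "alg_ideal J L"
  shows "alg_ideal (bracket_space L I J) L"
proof (rule ideal_if_left)
  let ?S = "{x \<otimes> y |x y. x \<in> I \<and> y \<in> J}" and ?B = "bracket_space L I J"
  have sI: "I \<subseteq> carrier L" and sJ: "J \<subseteq> carrier L"
    using alg_idealD(1)[OF I] alg_idealD(1)[OF J] by (auto simp: submodule_iff)
  then have S: "?S \<subseteq> carrier L" using prod_closed by auto
  show sub: "submodule ?B scalars L" unfolding bracket_space_def by (rule lin_span_submodule[OF S])
  have zero: "\<zero> \<in> ?B" and add: "\<And>u v. \<lbrakk>u \<in> ?B; v \<in> ?B\<rbrakk> \<Longrightarrow> u \<oplus> v \<in> ?B"
    and smult: "\<And>c u. u \<in> ?B \<Longrightarrow> c \<odot> u \<in> ?B"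
    using sub unfolding submodule_iff by blast+
  have mem: "u \<otimes> v \<in> ?B" if "u \<in> I" "v \<in> J" for u v
    unfolding bracket_space_def by (rule subsetD[OF lin_span_superset]) (use that in blast)
  fix a x assume a: "a \<in> carrier L" and x: "x \<in> ?B"
  let ?H = "{x \<in> carrier L. a \<otimes> x \<in> ?B}"
  have "submodule ?H scalars L"
    unfolding submodule_iff
  proof (intro conjI ballI allI)
    show "\<zero> \<in> ?H" using zero a by (simp add: prod_zero_right)
  next
    fix u v assume "u \<in> ?H" "v \<in> ?H"
    then show "u \<oplus> v \<in> ?H" using add prod_add_right[OF a, of u v] by simp
  next
    fix c u assume "u \<in> ?H"
    then show "c \<odot> u \<in> ?H" using smult prod_smult_right[OF a, of u c] by simp
  qed simp
  moreover have "?S \<subseteq> ?H"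
  proof
    fix s assume "s \<in> ?S"
    then obtain x y where s: "s = x \<otimes> y" "x \<in> I" "y \<in> J" by auto
    then have c: "x \<in> carrier L" "y \<in> carrier L" using sI sJ by auto
    then have p: "x \<otimes> y \<in> carrier L" "a \<otimes> x \<in> carrier L" "y \<otimes> a \<in> carrier L"
      "a \<otimes> (x \<otimes> y) \<in> carrier L" "x \<otimes> (y \<otimes> a) \<in> carrier L" "y \<otimes> (a \<otimes> x) \<in> carrier L"
      using a by (simp_all add: prod_closed)
    have 1: "x \<otimes> (y \<otimes> a) \<in> ?B" by (rule mem[OF s(2) alg_idealD(3)[OF J a s(3)]])
    have "(a \<otimes> x) \<otimes> y \<in> ?B" by (rule mem[OF alg_idealD(2)[OF I a s(2)] s(3)])
    then have 2: "y \<otimes> (a \<otimes> x) \<in> ?B" using skew[OF c(2) p(2)] smult by simp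
    have "a \<otimes> (x \<otimes> y) \<oplus> (x \<otimes> (y \<otimes> a) \<oplus> y \<otimes> (a \<otimes> x)) = \<zero>"
      using jacobi[OF a c] p by (simp add: M.a_assoc)
    then have "a \<otimes> (x \<otimes> y) = \<ominus> (x \<otimes> (y \<otimes> a) \<oplus> y \<otimes> (a \<otimes> x))"
      using p M.minus_equality by (metis M.a_closed)
    also have "\<dots> = (-1) \<odot> (x \<otimes> (y \<otimes> a) \<oplus> y \<otimes> (a \<otimes> x))"
      using p by (intro neg_eq_smult) simp
    also have "\<dots> \<in> ?B" by (intro smult add 1 2)
    finally show "s \<in> ?H" using s(1) p by simp
  qed
  ultimately have "?B \<subseteq> ?H" unfolding bracket_space_def by (rule lin_span_least)
  then show "a \<otimes> x \<in> ?B" using x by auto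
qed

lemma central_series_ideal: "alg_ideal (central_series L r) L"
  by (induction r) (simp_all add: carrier_ideal ideal_bracket)

lemma second_derived_ideal: "alg_ideal (second_derived L) L"
  by (simp add: second_derived_def derived_def carrier_ideal ideal_bracket)

end

lemma nonassoc_algebra_free: "nonassoc_algebra (free_nonassoc X :: ('k::field, 'x magma \<Rightarrow> 'k) module)"
proof -
  let ?A = "free_nonassoc X :: ('k, 'x magma \<Rightarrow> 'k) module"
  have add: "(\<lambda>t. f t + g t) \<in> carrier ?A" if "f \<in> carrier ?A" "g \<in> carrier ?A" for f g
  proof -
    have "finite ({t. f t \<noteq> 0} \<union> {t. g t \<noteq> 0})" using that by (auto simp: free_nonassoc_def)
    then have "finite {t. f t + g t \<noteq> 0}" by (rule rev_finite_subset) auto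
    with that show ?thesis by (simp add: free_nonassoc_def) (metis add.right_neutral)
  qed
  have smult: "(\<lambda>t. c * f t) \<in> carrier ?A" if "f \<in> carrier ?A" for c f
    using that by (auto simp: free_nonassoc_def)
  have prod: "magma_prod f g \<in> carrier ?A" if "f \<in> carrier ?A" "g \<in> carrier ?A" for f g
  proof -
    have *: "t \<in> case_prod Node ` ({t. f t \<noteq> 0} \<times> {t. g t \<noteq> 0})" if "magma_prod f g t \<noteq> 0" for t
      using that by (cases t) auto
    have "finite {t. magma_prod f g t \<noteq> 0}"
      by (rule finite_subset[of _ "case_prod Node ` ({t. f t \<noteq> 0} \<times> {t. g t \<noteq> 0})"])
        (use * that in \<open>auto simp: free_nonassoc_def\<close>)
    moreover have "set_magma t \<subseteq> X" if t: "magma_prod f g t \<noteq> 0" for t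
      using *[OF t] that(1) \<open>f \<in> _\<close> \<open>g \<in> _\<close>
      by (clarsimp simp: free_nonassoc_def) (meson UnE subsetD)
    ultimately show ?thesis by (simp add: free_nonassoc_def)
  qed
  have ops [simp]: "mult ?A = magma_prod" "zero ?A = (\<lambda>t. 0)" "add ?A = (\<lambda>f g t. f t + g t)"
    "smult ?A = (\<lambda>c f t. c * f t)" by (simp_all add: free_nonassoc_def)
  have ext: "magma_prod f g = h" if "\<And>i. h (Leaf i) = 0" "\<And>s t. h (Node s t) = f s * g t"
    for f g h :: "'x magma \<Rightarrow> 'k"
  proof
    fix t show "magma_prod f g t = h t" using that by (cases t) auto
  qed
  show ?thesis
  proof (intro nonassoc_algebra.intro nonassoc_algebra_axioms.intro moduleI cring_scalars)
    show "abelian_group ?A"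
    proof (rule abelian_groupI)
      show "\<zero>\<^bsub>?A\<^esub> \<in> carrier ?A" by (simp add: free_nonassoc_def)
      fix f assume "f \<in> carrier ?A"
      then show "\<exists>g\<in>carrier ?A. g \<oplus>\<^bsub>?A\<^esub> f = \<zero>\<^bsub>?A\<^esub>"
        by (intro bexI[OF _ smult[of f "-1"]]) auto
    qed (auto simp: add algebra_simps)
  qed (auto simp: add smult prod algebra_simps intro!: ext)
qed

lemma lie_algebra_free_lie: "lie_algebra (free_lie X :: ('k::field, ('x magma \<Rightarrow> 'k) set) module)"
proof -
  let ?A = "free_nonassoc X :: ('k, 'x magma \<Rightarrow> 'k) module"
  interpret A: nonassoc_algebra ?A by (rule nonassoc_algebra_free)
  have "lie_relations ?A \<subseteq> carrier ?A" using A.prod_closed by (auto simp: lie_relations_def)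
  then interpret alg_quotient ?A "gen_ideal ?A (lie_relations ?A)"
    by unfold_locales (rule A.gen_ideal_ideal)
  show ?thesis unfolding free_lie_def by (rule lie_algebra_quot) (rule A.gen_ideal_superset)
qed

lemma (in lie_algebra) lie_algebra_quotient:
  assumes I: "alg_ideal I L" shows "lie_algebra (quot_algebra L I)"
proof -
  interpret alg_quotient L I by unfold_locales (rule I)
  have "lie_relations L \<subseteq> {\<zero>}" by (auto simp: lie_relations_def alternating jacobi)
  then show ?thesis using I.zero_closed by (intro lie_algebra_quot) auto
qed

lemma lie_algebra_free_metabelian_nilpotent:
  "lie_algebra (free_metabelian_nilpotent m k :: ('k::field, (nat magma \<Rightarrow> 'k) set set) module)"
proof -
  let ?F = "free_lie {..<m} :: ('k, (nat magma \<Rightarrow> 'k) set) module"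
  interpret F: lie_algebra ?F by (rule lie_algebra_free_lie)
  show ?thesis
    unfolding free_metabelian_nilpotent_def Let_def
    by (intro F.lie_algebra_quotient F.ideal_sum F.central_series_ideal F.second_derived_ideal)
qed

end

theory Submission
  imports Defs
begin

text \<open>
  Let \<open>B\<close> be a metric on a metabelian \<open>L\<close>. Since \<open>B([b, u], v) = B(b, [u, v]) = 0\<close> for \<open>u, v \<in> L'\<close>,
  the space \<open>[L, L']\<close> is central, which excludes \<open>k \<ge> 4\<close>. A central element is orthogonal to
  \<open>L'\<close>, hence determined by its pairings with the \<open>m\<close> generators. For \<open>k = 2\<close>, \<open>m \<ge> 4\<close> and for
  \<open>k = 3\<close>, \<open>m \<ge> 3\<close> this contradicts the presence of more than \<open>m\<close> independent central elements
  \<open>[x\<^sub>p, x\<^sub>q]\<close> resp. \<open>[x\<^sub>p, [x\<^sub>p, x\<^sub>q]]\<close>; their independence is detected by homomorphisms to a filiform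
  Lie algebra. For \<open>k = m = 2\<close> the element \<open>[x\<^sub>0, x\<^sub>1]\<close> is orthogonal to everything. In the two
  remaining cases a metric is pulled back from an explicit isomorphic Lie algebra.
\<close>


section \<open>Homogeneous linear systems\<close>

text \<open>Gaussian elimination by induction on the number \<open>n\<close> of equations: the last
  equation either vanishes identically or is solved for one unknown \<open>q\<close>.\<close>

lemma underdetermined_system:
  fixes a :: "'p \<Rightarrow> nat \<Rightarrow> 'k::field"
  assumes "finite P" "n < card P"
  shows "\<exists>c. (\<exists>p\<in>P. c p \<noteq> 0) \<and> (\<forall>i<n. (\<Sum>p\<in>P. c p * a p i) = 0)"
  using assms
proof (induction n arbitrary: P a)
  case 0
  then have "P \<noteq> {}" by auto
  then show ?case by (intro exI[of _ "\<lambda>_. 1"]) auto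
next
  case (Suc n)
  show ?case
  proof (cases "\<forall>p\<in>P. a p n = 0")
    case True
    then show ?thesis using Suc.IH[of P a] Suc.prems by (auto simp: less_Suc_eq)
  next
    case False
    then obtain q where q: "q \<in> P" "a q n \<noteq> 0" by blast
    define P' where "P' = P - {q}"
    \<comment> \<open>Equation \<open>i\<close> minus \<open>a q i / a q n\<close> times equation
      \<open>n\<close>, so that the unknown \<open>q\<close> drops out.\<close>
    define a' where "a' p i = a p i - a p n / a q n * a q i" for p i
    have P': "finite P'" "P = insert q P'" "q \<notin> P'" "n < card P'"
      using q Suc.prems by (auto simp: P'_def)
    obtain c' where c': "\<exists>p\<in>P'. c' p \<noteq> 0" "\<forall>i<n. (\<Sum>p\<in>P'. c' p * a' p i) = 0"
      using Suc.IH[of P' a'] P' by blast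
    define s where "s = (\<Sum>p\<in>P'. c' p * a p n)"
    \<comment> \<open>The value at \<open>q\<close> is the one forced by equation
      \<open>n\<close>.\<close>
    define c where "c = c'(q := - s / a q n)"
    have split: "(\<Sum>p\<in>P. c p * a p i) = (\<Sum>p\<in>P'. c' p * a p i) - s / a q n * a q i" for i
    proof -
      have "(\<Sum>p\<in>P'. c p * a p i) = (\<Sum>p\<in>P'. c' p * a p i)"
        using P'(3) by (intro sum.cong) (auto simp: c_def)
      then show ?thesis using P' by (simp add: c_def)
    qed
    have "(\<Sum>p\<in>P. c p * a p i) = 0" if "i < Suc n" for i
    proof (cases "i = n")
      case True
      then show ?thesis using q by (simp add: split s_def)
    next
      case False
      then have "0 = (\<Sum>p\<in>P'. c' p * a' p i)" using c'(2) that by auto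
      also have "\<dots> = (\<Sum>p\<in>P'. c' p * a p i) - (\<Sum>p\<in>P'. c' p * a p n * (a q i / a q n))"
        unfolding sum_subtractf[symmetric] by (intro sum.cong) (auto simp: a'_def algebra_simps)
      finally show ?thesis by (simp add: split s_def sum_distrib_right sum_divide_distrib)
    qed
    moreover have "\<exists>p\<in>P. c p \<noteq> 0" using c'(1) P' by (auto simp: c_def)
    ultimately show ?thesis by blast
  qed
qed


section \<open>Generators\<close>

text \<open>Generation as an induction principle: a property of all elements follows once it holds
  on \<open>G\<close> and defines a subalgebra.\<close>

definition generates :: "('k::field, 'a) module \<Rightarrow> 'a set \<Rightarrow> bool" where
  "generates A G \<longleftrightarrow> G \<subseteq> carrier A \<and>
     (\<forall>H. submodule H scalars A \<and> (\<forall>x\<in>H. \<forall>y\<in>H. x \<otimes>\<^bsub>A\<^esub> y \<in> H) \<and> G \<subseteq> H \<longrightarrow> carrier A \<subseteq> H)"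

lemma generatesD:
  assumes "generates A G"
  shows "G \<subseteq> carrier A"
    and "\<lbrakk>submodule H scalars A; \<And>x y. \<lbrakk>x \<in> H; y \<in> H\<rbrakk> \<Longrightarrow> x \<otimes>\<^bsub>A\<^esub> y \<in> H; G \<subseteq> H\<rbrakk> \<Longrightarrow> carrier A \<subseteq> H"
  using assms unfolding generates_def by blast+

definition leaf_vec :: "'x \<Rightarrow> 'x magma \<Rightarrow> 'k::field" where
  "leaf_vec i = (\<lambda>t. if t = Leaf i then 1 else 0)"

lemma free_nonassoc_simps:
  "mult (free_nonassoc X) = magma_prod" "zero (free_nonassoc X) = (\<lambda>t. 0)"
  "add (free_nonassoc X) = (\<lambda>f g t. f t + g t)" "smult (free_nonassoc X) = (\<lambda>c f t. c * f t)"
  "f \<in> carrier (free_nonassoc X) \<longleftrightarrow> finite {t. f t \<noteq> 0} \<and> (\<forall>t. f t \<noteq> 0 \<longrightarrow> set_magma t \<subseteq> X)"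
  by (simp_all add: free_nonassoc_def)

text \<open>The indicator functions of trees span, and the indicator of \<open>Node s t\<close> is
  the product of those of \<open>s\<close> and \<open>t\<close>.\<close>

lemma generates_free_nonassoc:
  "generates (free_nonassoc X :: ('k::field, 'x magma \<Rightarrow> 'k) module) (leaf_vec ` X)"
  unfolding generates_def
proof (intro conjI allI impI; (elim conjE)?)
  show "leaf_vec ` X \<subseteq> carrier (free_nonassoc X :: ('k, 'x magma \<Rightarrow> 'k) module)"
    by (auto simp: free_nonassoc_simps leaf_vec_def)
next
  let ?A = "free_nonassoc X :: ('k, 'x magma \<Rightarrow> 'k) module"
  interpret nonassoc_algebra ?A by (rule nonassoc_algebra_free)
  fix H assume sub: "submodule H scalars ?A" and closed: "\<forall>x\<in>H. \<forall>y\<in>H. x \<otimes>\<^bsub>?A\<^esub> y \<in> H"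
    and gen: "leaf_vec ` X \<subseteq> H"
  define ind :: "'x magma \<Rightarrow> 'x magma \<Rightarrow> 'k" where "ind t = (\<lambda>u. if u = t then 1 else 0)" for t
  have ind: "ind t \<in> H" if "set_magma t \<subseteq> X" for t
    using that
  proof (induction t)
    case (Leaf i)
    then show ?case using gen by (auto simp: ind_def leaf_vec_def)
  next
    case (Node s t)
    have "ind (Node s t) u = magma_prod (ind s) (ind t) u" for u
      by (cases u) (auto simp: ind_def)
    then have "ind (Node s t) = magma_prod (ind s) (ind t)" by blast
    then show ?case using Node closed by (auto simp: free_nonassoc_simps)
  qed
  have H: "(\<lambda>t. 0) \<in> H" "\<And>f g. \<lbrakk>f \<in> H; g \<in> H\<rbrakk> \<Longrightarrow> (\<lambda>t. f t + g t) \<in> H"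
    "\<And>c f. f \<in> H \<Longrightarrow> (\<lambda>t. c * f t) \<in> H"
    using sub unfolding submodule_iff by (auto simp: free_nonassoc_simps)
  \<comment> \<open>The induction runs over a finite set containing the support; each step splits
    off the value of \<open>f\<close> at one tree \<open>u\<close>.\<close>
  have "f \<in> H" if "finite S" "{t. f t \<noteq> 0} \<subseteq> S" "\<forall>t\<in>S. set_magma t \<subseteq> X" for S f
    using that
  proof (induction S arbitrary: f)
    case empty
    then have "f = (\<lambda>t. 0)" by auto
    then show ?case using H by simp
  next
    case (insert u S)
    have "f(u := 0) \<in> H" by (rule insert.IH) (use insert.prems in auto)
    moreover have "(\<lambda>t. f u * ind u t) \<in> H" using H ind insert.prems by auto
    ultimately have "(\<lambda>t. (f(u := 0)) t + f u * ind u t) \<in> H" by (rule H)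
    also have "(\<lambda>t. (f(u := 0)) t + f u * ind u t) = f" by (auto simp: ind_def)
    finally show ?case .
  qed
  then show "carrier ?A \<subseteq> H" by (auto simp: free_nonassoc_simps)
qed

text \<open>The preimage in \<open>A\<close> of a subalgebra of the quotient is a subalgebra of
  \<open>A\<close>.\<close>

lemma (in alg_quotient) generates_quot:
  assumes "generates A G" shows "generates Q ((\<lambda>x. I +> x) ` G)"
  unfolding generates_def
proof (intro conjI allI impI; (elim conjE)?)
  show "(\<lambda>x. I +> x) ` G \<subseteq> carrier Q" using generatesD(1)[OF assms] by auto
next
  fix H assume sub: "submodule H scalars Q" and closed: "\<forall>x\<in>H. \<forall>y\<in>H. x \<otimes>\<^bsub>Q\<^esub> y \<in> H"
    and gen: "(\<lambda>x. I +> x) ` G \<subseteq> H"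
  interpret Q: nonassoc_algebra Q by (rule nonassoc_algebra_quot)
  let ?H = "{x \<in> carrier A. I +> x \<in> H}"
  have H: "\<zero>\<^bsub>Q\<^esub> \<in> H" "\<And>x y. \<lbrakk>x \<in> H; y \<in> H\<rbrakk> \<Longrightarrow> x \<oplus>\<^bsub>Q\<^esub> y \<in> H"
    "\<And>c x. x \<in> H \<Longrightarrow> c \<odot>\<^bsub>Q\<^esub> x \<in> H"
    using sub unfolding Q.submodule_iff by auto
  have "submodule ?H scalars A"
    unfolding submodule_iff
  proof (intro conjI ballI allI)
    show "\<zero> \<in> ?H" using H(1) I.zero_closed by (simp add: quot_zero)
  next
    fix x y assume "x \<in> ?H" "y \<in> ?H"
    then show "x \<oplus> y \<in> ?H" using H(2)[of "I +> x" "I +> y"] by (simp add: quot_add)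
  next
    fix c x assume "x \<in> ?H"
    then show "c \<odot> x \<in> ?H" using H(3)[of "I +> x" c] by (simp add: quot_smult)
  qed simp
  moreover have "x \<otimes> y \<in> ?H" if "x \<in> ?H" "y \<in> ?H" for x y
    using closed that prod_closed by (auto simp: quot_mult[symmetric])
  moreover have "G \<subseteq> ?H" using gen generatesD(1)[OF assms] by auto
  ultimately have "carrier A \<subseteq> ?H" by (rule generatesD(2)[OF assms])
  then show "carrier Q \<subseteq> H" by (auto elim!: cosetE)
qed


section \<open>Homomorphisms to algebras of coordinate vectors\<close>

text \<open>The target is a whole function space with a bare bracket \<open>br\<close>; without a
  carrier, the laws of \<open>br\<close> become plain equations between functions.\<close>

definition coord_hom ::
    "('k::field, 'a) module \<Rightarrow> (('i \<Rightarrow> 'k) \<Rightarrow> ('i \<Rightarrow> 'k) \<Rightarrow> 'i \<Rightarrow> 'k) \<Rightarrow> ('a \<Rightarrow> 'i \<Rightarrow> 'k) \<Rightarrow> bool" where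
  "coord_hom A br h \<longleftrightarrow>
     (\<forall>x\<in>carrier A. \<forall>y\<in>carrier A. h (x \<oplus>\<^bsub>A\<^esub> y) = (\<lambda>n. h x n + h y n)) \<and>
     (\<forall>c. \<forall>x\<in>carrier A. h (c \<odot>\<^bsub>A\<^esub> x) = (\<lambda>n. c * h x n)) \<and>
     (\<forall>x\<in>carrier A. \<forall>y\<in>carrier A. h (x \<otimes>\<^bsub>A\<^esub> y) = br (h x) (h y))"

lemma coord_homD:
  assumes "coord_hom A br h" "x \<in> carrier A"
  shows "y \<in> carrier A \<Longrightarrow> h (x \<oplus>\<^bsub>A\<^esub> y) = (\<lambda>n. h x n + h y n)"
    and "h (c \<odot>\<^bsub>A\<^esub> x) = (\<lambda>n. c * h x n)"
    and "y \<in> carrier A \<Longrightarrow> h (x \<otimes>\<^bsub>A\<^esub> y) = br (h x) (h y)"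
  using assms unfolding coord_hom_def by blast+

context nonassoc_algebra
begin

lemma coord_hom_zero: "coord_hom A br h \<Longrightarrow> h \<zero> = (\<lambda>n. 0)"
  using coord_homD(2)[of A br h \<zero> 0] by simp

lemma coord_hom_finsum:
  assumes h: "coord_hom A br h" and "finite P" "\<And>p. p \<in> P \<Longrightarrow> v p \<in> carrier A"
  shows "h (\<Oplus>p\<in>P. v p) = (\<lambda>n. \<Sum>p\<in>P. h (v p) n)"
  using assms(2,3)
proof (induction P)
  case empty
  then show ?case by (simp add: coord_hom_zero[OF h])
next
  case (insert p P)
  then have "v \<in> P \<rightarrow> carrier A" by auto
  then show ?case using insert by (simp add: coord_homD[OF h])
qed

end

lemma (in alg_quotient) coord_hom_quot:
  assumes h: "coord_hom A br h" and ker: "\<And>x. x \<in> I \<Longrightarrow> h x = (\<lambda>n. 0)"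
  obtains h' where "coord_hom Q br h'" "\<And>x. x \<in> carrier A \<Longrightarrow> h' (I +> x) = h x"
proof
  \<comment> \<open>Since \<open>h\<close> kills \<open>I\<close>, it is constant on each coset;
    \<open>the_elem\<close> extracts that value.\<close>
  let ?h = "\<lambda>X. the_elem (h ` X)"
  show val: "?h (I +> x) = h x" if x: "x \<in> carrier A" for x
  proof -
    have "h y = h x" if "y \<in> I +> x" for y
      using that x I.a_subset by (auto simp: coset_mem coord_homD[OF h] ker)
    then have "h ` (I +> x) = {h x}" using I.a_rcos_self[OF x] by blast
    then show ?thesis by simp
  qed
  have "\<forall>X\<in>carrier Q. \<forall>Y\<in>carrier Q. ?h (X \<oplus>\<^bsub>Q\<^esub> Y) = (\<lambda>n. ?h X n + ?h Y n)"
    "\<forall>X\<in>carrier Q. \<forall>c. ?h (c \<odot>\<^bsub>Q\<^esub> X) = (\<lambda>n. c * ?h X n)"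
    "\<forall>X\<in>carrier Q. \<forall>Y\<in>carrier Q. ?h (X \<otimes>\<^bsub>Q\<^esub> Y) = br (?h X) (?h Y)"
    unfolding quot_forall by (simp_all add: quot_ops val coord_homD[OF h] prod_closed)
  then show "coord_hom Q br ?h" by (simp add: coord_hom_def)
qed

section \<open>Linear extension of tree evaluation, and graded brackets\<close>

primrec magma_eval :: "('v \<Rightarrow> 'v \<Rightarrow> 'v) \<Rightarrow> ('x \<Rightarrow> 'v) \<Rightarrow> 'x magma \<Rightarrow> 'v" where
  "magma_eval br g (Leaf i) = g i"
| "magma_eval br g (Node s t) = br (magma_eval br g s) (magma_eval br g t)"

text \<open>For bilinear \<open>br\<close>, this is the homomorphism given by the universal property
  of the free nonassociative algebra.\<close>

definition magma_lift ::
    "(('i \<Rightarrow> 'k::field) \<Rightarrow> ('i \<Rightarrow> 'k) \<Rightarrow> 'i \<Rightarrow> 'k) \<Rightarrow> ('x \<Rightarrow> 'i \<Rightarrow> 'k) \<Rightarrow> ('x magma \<Rightarrow> 'k) \<Rightarrow> 'i \<Rightarrow> 'k" where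
  "magma_lift br g f = (\<lambda>n. \<Sum>t | f t \<noteq> 0. f t * magma_eval br g t n)"

text \<open>Any finite superset of the support may serve as summation range, so that several vectors
  can share one.\<close>

lemma magma_lift_eq:
  assumes "finite S" "{t. f t \<noteq> 0} \<subseteq> S"
  shows "magma_lift br g f = (\<lambda>n. \<Sum>t\<in>S. f t * magma_eval br g t n)"
  unfolding magma_lift_def using assms by (intro ext sum.mono_neutral_left) auto

lemma magma_lift_leaf: "magma_lift br g (leaf_vec i) = g i"
  by (subst magma_lift_eq[of "{Leaf i}"]) (auto simp: leaf_vec_def)

text \<open>
  A bracket on coordinate vectors that is graded by \<open>deg\<close>, where the vectors vanishing in degrees
  at most \<open>r\<close> form the \<open>r\<close>-th step of a filtration containing the central descending series.
\<close>

locale graded_bracket =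
  fixes br :: "('i \<Rightarrow> 'k::field) \<Rightarrow> ('i \<Rightarrow> 'k) \<Rightarrow> 'i \<Rightarrow> 'k" and deg :: "'i \<Rightarrow> nat" and k :: nat
  assumes br_add_left: "br (\<lambda>n. f n + f' n) g = (\<lambda>n. br f g n + br f' g n)"
    and br_add_right: "br f (\<lambda>n. g n + g' n) = (\<lambda>n. br f g n + br f g' n)"
    and br_smult_left: "br (\<lambda>n. c * f n) g = (\<lambda>n. c * br f g n)"
    and br_smult_right: "br f (\<lambda>n. c * g n) = (\<lambda>n. c * br f g n)"
    and br_alternating: "br f f = (\<lambda>n. 0)"
    and br_jacobi: "br f (br g h) n + br g (br h f) n + br h (br f g) n = 0"
    and deg_pos: "0 < deg n"
    and deg_le: "deg n \<le> k"
    and br_deg: "\<lbrakk>\<And>n. deg n \<le> r \<Longrightarrow> g n = 0; deg n \<le> Suc r\<rbrakk> \<Longrightarrow> br f g n = 0"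
    and br_metabelian:
      "\<lbrakk>\<And>n. deg n \<le> 1 \<Longrightarrow> f n = 0; \<And>n. deg n \<le> 1 \<Longrightarrow> g n = 0\<rbrakk> \<Longrightarrow> br f g = (\<lambda>n. 0)"
begin

lemma br_zero_left: "br (\<lambda>n. 0) g = (\<lambda>n. 0)"
  using br_smult_left[of 0 "\<lambda>n. 0" g] by simp

lemma br_zero_right: "br f (\<lambda>n. 0) = (\<lambda>n. 0)"
  using br_smult_right[of f 0 "\<lambda>n. 0"] by simp

lemma br_sum_left:
  "finite S \<Longrightarrow> br (\<lambda>n. \<Sum>s\<in>S. c s * F s n) g = (\<lambda>n. \<Sum>s\<in>S. c s * br (F s) g n)"
  by (induction S rule: finite_induct) (simp_all add: br_zero_left br_add_left br_smult_left)

lemma br_sum_right: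
  "finite S \<Longrightarrow> br f (\<lambda>n. \<Sum>s\<in>S. c s * F s n) = (\<lambda>n. \<Sum>s\<in>S. c s * br f (F s) n)"
  by (induction S rule: finite_induct) (simp_all add: br_zero_right br_add_right br_smult_right)

lemma coord_hom_magma_lift:
  "coord_hom (free_nonassoc X :: ('k, 'x magma \<Rightarrow> 'k) module) br (magma_lift br g)"
  unfolding coord_hom_def
proof (intro conjI ballI allI)
  fix u v :: "'x magma \<Rightarrow> 'k"
  assume uv: "u \<in> carrier (free_nonassoc X)" "v \<in> carrier (free_nonassoc X)"
  let ?U = "{t. u t \<noteq> 0}" and ?V = "{t. v t \<noteq> 0}" and ?e = "magma_eval br g"
  have fin: "finite ?U" "finite ?V" using uv by (auto simp: free_nonassoc_simps)
  have "magma_lift br g u = (\<lambda>n. \<Sum>t\<in>?U \<union> ?V. u t * ?e t n)"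
    "magma_lift br g v = (\<lambda>n. \<Sum>t\<in>?U \<union> ?V. v t * ?e t n)"
    "magma_lift br g (\<lambda>t. u t + v t) = (\<lambda>n. \<Sum>t\<in>?U \<union> ?V. (u t + v t) * ?e t n)"
    using fin by (auto intro!: magma_lift_eq)
  then show "magma_lift br g (u \<oplus>\<^bsub>free_nonassoc X\<^esub> v) = (\<lambda>n. magma_lift br g u n + magma_lift br g v n)"
    by (simp add: free_nonassoc_simps sum.distrib[symmetric] distrib_right)
  \<comment> \<open>The support of a product lies in the image under \<open>Node\<close> of the
    product of the supports; \<open>Node\<close> is injective, so the sum becomes a double
    sum.\<close>
  have "magma_lift br g (magma_prod u v) =
      (\<lambda>n. \<Sum>t\<in>case_prod Node ` (?U \<times> ?V). magma_prod u v t * ?e t n)"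
  proof (rule magma_lift_eq)
    have "t \<in> case_prod Node ` (?U \<times> ?V)" if "magma_prod u v t \<noteq> 0" for t
      using that by (cases t) auto
    then show "{t. magma_prod u v t \<noteq> 0} \<subseteq> case_prod Node ` (?U \<times> ?V)" by blast
  qed (use fin in auto)
  also have "\<dots> = (\<lambda>n. \<Sum>(s, t)\<in>?U \<times> ?V. u s * v t * br (?e s) (?e t) n)"
    by (subst sum.reindex) (auto simp: inj_on_def case_prod_beta)
  also have "\<dots> = (\<lambda>n. \<Sum>s\<in>?U. u s * (\<Sum>t\<in>?V. v t * br (?e s) (?e t) n))"
    by (simp add: sum.cartesian_product[symmetric] sum_distrib_left mult.assoc)
  also have "\<dots> = br (magma_lift br g u) (magma_lift br g v)"
    using fin by (simp add: magma_lift_def br_sum_left br_sum_right)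
  finally show "magma_lift br g (u \<otimes>\<^bsub>free_nonassoc X\<^esub> v) = br (magma_lift br g u) (magma_lift br g v)"
    by (simp add: free_nonassoc_simps)
next
  fix c and u :: "'x magma \<Rightarrow> 'k" assume "u \<in> carrier (free_nonassoc X)"
  then have "finite {t. u t \<noteq> 0}" by (simp add: free_nonassoc_simps)
  then have "magma_lift br g (\<lambda>t. c * u t) = (\<lambda>n. \<Sum>t | u t \<noteq> 0. c * u t * magma_eval br g t n)"
    by (intro magma_lift_eq) auto
  then show "magma_lift br g (c \<odot>\<^bsub>free_nonassoc X\<^esub> u) = (\<lambda>n. c * magma_lift br g u n)"
    by (simp add: free_nonassoc_simps magma_lift_def sum_distrib_left mult.assoc)
qed

lemma kernel_ideal:
  assumes "nonassoc_algebra A" and h: "coord_hom A br h"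
  shows "alg_ideal {x \<in> carrier A. h x = (\<lambda>n. 0)} A"
proof -
  interpret nonassoc_algebra A by fact
  show ?thesis
    unfolding alg_ideal_def submodule_iff
    by (auto simp: coord_hom_zero[OF h] coord_homD[OF h] prod_closed br_zero_left br_zero_right)
qed

text \<open>By \<open>br_deg\<close>, each further bracket moves a vector one step down the
  filtration.\<close>

lemma central_series_coords:
  assumes "nonassoc_algebra A" and h: "coord_hom A br h"
  shows "central_series A r \<subseteq> {x \<in> carrier A. \<forall>n. deg n \<le> r \<longrightarrow> h x n = 0}"
proof (induction r)
  case 0
  \<comment> \<open>Degrees are positive, so the condition for \<open>r = 0\<close> is
    vacuous.\<close>
  have "deg n \<le> 0 \<longrightarrow> h x n = 0" for x n using deg_pos[of n] by simp
  then show ?case by auto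
next
  case (Suc r)
  interpret nonassoc_algebra A by fact
  let ?H = "{x \<in> carrier A. \<forall>n. deg n \<le> Suc r \<longrightarrow> h x n = 0}"
  have "submodule ?H scalars A"
    unfolding submodule_iff by (auto simp: coord_hom_zero[OF h] coord_homD[OF h])
  moreover have "x \<otimes>\<^bsub>A\<^esub> y \<in> ?H" if "x \<in> carrier A" "y \<in> central_series A r" for x y
  proof -
    have y: "y \<in> carrier A" "\<And>n. deg n \<le> r \<Longrightarrow> h y n = 0" using Suc that(2) by auto
    then show ?thesis using br_deg[of r "h y"] that(1) by (simp add: coord_homD[OF h] prod_closed)
  qed
  then have "{x \<otimes>\<^bsub>A\<^esub> y |x y. x \<in> carrier A \<and> y \<in> central_series A r} \<subseteq> ?H" by blast
  ultimately show ?case unfolding central_series.simps bracket_space_def by (rule lin_span_least)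
qed

lemma second_derived_coords:
  assumes "nonassoc_algebra A" and h: "coord_hom A br h"
  shows "second_derived A \<subseteq> {x \<in> carrier A. h x = (\<lambda>n. 0)}"
proof -
  \<comment> \<open>Elements of \<open>C^1\<close> have vanishing coordinates in degree 1, which is
    the hypothesis of \<open>br_metabelian\<close>.\<close>
  have "derived A = central_series A 1" by (simp add: derived_def)
  then have "derived A \<subseteq> {x \<in> carrier A. \<forall>n. deg n \<le> 1 \<longrightarrow> h x n = 0}"
    using central_series_coords[OF assms, of 1] by simp
  then have "{x \<otimes>\<^bsub>A\<^esub> y |x y. x \<in> derived A \<and> y \<in> derived A} \<subseteq> {x \<in> carrier A. h x = (\<lambda>n. 0)}"
    by (auto simp: coord_homD[OF h] nonassoc_algebra.prod_closed[OF assms(1)] subset_iff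
        intro!: br_metabelian)
  then show ?thesis
    unfolding second_derived_def bracket_space_def
    by (intro nonassoc_algebra.lin_span_least[OF assms(1)] alg_idealD(1) kernel_ideal[OF assms])
qed

end


section \<open>The presentation of the free metabelian nilpotent Lie algebra\<close>

definition free_lie_gen :: "'x set \<Rightarrow> 'x \<Rightarrow> ('x magma \<Rightarrow> 'k::field) set" where
  "free_lie_gen X i = gen_ideal (free_nonassoc X) (lie_relations (free_nonassoc X))
     +>\<^bsub>free_nonassoc X\<^esub> leaf_vec i"

definition fmn_gen :: "nat \<Rightarrow> nat \<Rightarrow> nat \<Rightarrow> (nat magma \<Rightarrow> 'k::field) set set" where
  "fmn_gen m k i = (let F = free_lie {..<m} in
     (central_series F k <+>\<^bsub>F\<^esub> second_derived F) +>\<^bsub>F\<^esub> free_lie_gen {..<m} i)"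

lemma alg_quotient_free_lie:
  "alg_quotient (free_nonassoc X :: ('k::field, 'x magma \<Rightarrow> 'k) module)
     (gen_ideal (free_nonassoc X) (lie_relations (free_nonassoc X)))"
proof -
  let ?A = "free_nonassoc X :: ('k, 'x magma \<Rightarrow> 'k) module"
  interpret A: nonassoc_algebra ?A by (rule nonassoc_algebra_free)
  have "lie_relations ?A \<subseteq> carrier ?A" using A.prod_closed by (auto simp: lie_relations_def)
  then show ?thesis by unfold_locales (rule A.gen_ideal_ideal)
qed

lemma generates_free_lie:
  "generates (free_lie X :: ('k::field, ('x magma \<Rightarrow> 'k) set) module) (free_lie_gen X ` X)"
  using alg_quotient.generates_quot[OF alg_quotient_free_lie generates_free_nonassoc, of X]
  by (simp add: free_lie_def free_lie_gen_def image_image)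

text \<open>The kernel of \<open>magma_lift br g\<close> is an ideal containing the Lie relations,
  hence it contains the ideal they generate.\<close>

lemma (in graded_bracket) coord_hom_free_lie:
  fixes X :: "'x set"
  obtains h where "coord_hom (free_lie X) br h" "\<And>i. i \<in> X \<Longrightarrow> h (free_lie_gen X i) = g i"
proof -
  let ?A = "free_nonassoc X :: ('k, 'x magma \<Rightarrow> 'k) module" and ?h = "magma_lift br g"
  let ?I = "gen_ideal ?A (lie_relations ?A)"
  interpret alg_quotient ?A ?I by (rule alg_quotient_free_lie)
  note h = coord_hom_magma_lift[of X g]
  have ideal: "alg_ideal {x \<in> carrier ?A. ?h x = (\<lambda>n. 0)} ?A"
    by (rule kernel_ideal[OF nonassoc_algebra_free h])
  have "lie_relations ?A \<subseteq> {x \<in> carrier ?A. ?h x = (\<lambda>n. 0)}"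
    unfolding lie_relations_def
    by (intro Un_least subsetI; clarify)
      (simp_all add: prod_closed coord_homD[OF h] br_alternating br_jacobi)
  then have "?I \<subseteq> {x \<in> carrier ?A. ?h x = (\<lambda>n. 0)}"
    using ideal unfolding gen_ideal_def by blast
  then obtain h' where h': "coord_hom Q br h'"
      "\<And>x. x \<in> carrier ?A \<Longrightarrow> h' (?I +>\<^bsub>?A\<^esub> x) = ?h x"
    using coord_hom_quot[OF h] by blast
  show thesis
  proof (rule that[of h'])
    show "coord_hom (free_lie X) br h'" using h'(1) by (simp add: free_lie_def)
    fix i assume "i \<in> X"
    then have "leaf_vec i \<in> carrier ?A"
      by (auto simp: free_nonassoc_simps leaf_vec_def)
    then show "h' (free_lie_gen X i) = g i"
      using h'(2) by (simp add: free_lie_gen_def magma_lift_leaf)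
  qed
qed

lemma alg_quotient_fmn:
  fixes m k :: nat and F :: "('k::field, (nat magma \<Rightarrow> 'k) set) module"
  defines "F \<equiv> free_lie {..<m}"
  shows "alg_quotient F (central_series F k <+>\<^bsub>F\<^esub> second_derived F)"
proof -
  interpret F: lie_algebra F unfolding F_def by (rule lie_algebra_free_lie)
  show ?thesis
    by unfold_locales (intro F.ideal_sum F.central_series_ideal F.second_derived_ideal)
qed

lemma generates_fmn:
  "generates (free_metabelian_nilpotent m k :: ('k::field, (nat magma \<Rightarrow> 'k) set set) module)
     (fmn_gen m k ` {..<m})"
  using alg_quotient.generates_quot[OF alg_quotient_fmn generates_free_lie]
  by (simp add: free_metabelian_nilpotent_def fmn_gen_def Let_def image_image)

lemma fmn_gen_closed:
  "i < m \<Longrightarrow> fmn_gen m k i \<in>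
     carrier (free_metabelian_nilpotent m k :: ('k::field, (nat magma \<Rightarrow> 'k) set set) module)"
  using generatesD(1)[OF generates_fmn] by blast

text \<open>\<open>C^k\<close> is killed because all degrees are at most \<open>k\<close>, and the
  second derived algebra by \<open>br_metabelian\<close>. This supplies every homomorphism used for
  independence and for the metrics.\<close>

lemma (in graded_bracket) coord_hom_fmn:
  obtains h where "coord_hom (free_metabelian_nilpotent m k) br h"
    "\<And>i. i < m \<Longrightarrow> h (fmn_gen m k i) = g i"
proof -
  let ?F = "free_lie {..<m} :: ('k, (nat magma \<Rightarrow> 'k) set) module"
  let ?J = "central_series ?F k <+>\<^bsub>?F\<^esub> second_derived ?F"
  interpret F: lie_algebra ?F by (rule lie_algebra_free_lie)
  interpret alg_quotient ?F ?J by (rule alg_quotient_fmn)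
  obtain h where h: "coord_hom ?F br h" "\<And>i. i \<in> {..<m} \<Longrightarrow> h (free_lie_gen {..<m} i) = g i"
    using coord_hom_free_lie by blast
  note na = F.nonassoc_algebra_axioms
  have "h x = (\<lambda>n. 0)" if x: "x \<in> ?J" for x
  proof -
    obtain y z where *: "x = y \<oplus>\<^bsub>?F\<^esub> z" "y \<in> central_series ?F k" "z \<in> second_derived ?F"
      using x unfolding set_add_def' by blast
    moreover have "y \<in> carrier ?F" "h y = (\<lambda>n. 0)"
      using central_series_coords[OF na h(1), of k] *(2) deg_le by auto
    moreover have "z \<in> carrier ?F" "h z = (\<lambda>n. 0)"
      using second_derived_coords[OF na h(1)] *(3) by auto
    ultimately show ?thesis by (simp add: coord_homD[OF h(1)])
  qed
  then obtain h' where h': "coord_hom Q br h'"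
      "\<And>x. x \<in> carrier ?F \<Longrightarrow> h' (?J +>\<^bsub>?F\<^esub> x) = h x"
    using coord_hom_quot[OF h(1)] by blast
  show thesis
  proof (rule that[of h'])
    show "coord_hom (free_metabelian_nilpotent m k) br h'"
      using h'(1) by (simp add: free_metabelian_nilpotent_def Let_def)
    fix i assume "i < m"
    then have "free_lie_gen {..<m} i \<in> carrier ?F" and i: "i \<in> {..<m}"
      using generatesD(1)[OF generates_free_lie, of "{..<m}"] by blast+
    then show "h' (fmn_gen m k i) = g i"
      unfolding fmn_gen_def Let_def using h'(2) h(2)[OF i] by metis
  qed
qed

section \<open>Identities in the quotient\<close>

lemma bracket_space_mem: "\<lbrakk>x \<in> U; y \<in> V\<rbrakk> \<Longrightarrow> x \<otimes>\<^bsub>L\<^esub> y \<in> bracket_space L U V"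
  unfolding bracket_space_def lin_span_def by blast

text \<open>Each left-hand side is represented by an element of \<open>C^k\<close> or of the second
  derived algebra. As indexing starts at \<open>C^0 = F\<close>, brackets of \<open>k + 1\<close>
  factors lie in \<open>C^k\<close>.\<close>

lemma fmn_laws:
  fixes m k :: nat and N :: "('k::field, (nat magma \<Rightarrow> 'k) set set) module"
  defines "N \<equiv> free_metabelian_nilpotent m k"
  shows fmn_metabelian: "\<lbrakk>a \<in> carrier N; b \<in> carrier N; c \<in> carrier N; d \<in> carrier N\<rbrakk> \<Longrightarrow>
      (a \<otimes>\<^bsub>N\<^esub> b) \<otimes>\<^bsub>N\<^esub> (c \<otimes>\<^bsub>N\<^esub> d) = \<zero>\<^bsub>N\<^esub>"
    and fmn_nilpotent_2: "\<lbrakk>k = 2; a \<in> carrier N; b \<in> carrier N; c \<in> carrier N\<rbrakk> \<Longrightarrow>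
      a \<otimes>\<^bsub>N\<^esub> (b \<otimes>\<^bsub>N\<^esub> c) = \<zero>\<^bsub>N\<^esub>"
    and fmn_nilpotent_3: "\<lbrakk>k = 3; a \<in> carrier N; b \<in> carrier N; c \<in> carrier N; d \<in> carrier N\<rbrakk> \<Longrightarrow>
      a \<otimes>\<^bsub>N\<^esub> (b \<otimes>\<^bsub>N\<^esub> (c \<otimes>\<^bsub>N\<^esub> d)) = \<zero>\<^bsub>N\<^esub>"
proof -
  let ?F = "free_lie {..<m} :: ('k, (nat magma \<Rightarrow> 'k) set) module"
  let ?J = "central_series ?F k <+>\<^bsub>?F\<^esub> second_derived ?F"
  interpret F: lie_algebra ?F by (rule lie_algebra_free_lie)
  interpret alg_quotient ?F ?J by (rule alg_quotient_fmn)
  have N: "N = Q" by (simp add: N_def free_metabelian_nilpotent_def Let_def)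
  have C: "submodule (central_series ?F k) scalars ?F"
    and D: "submodule (second_derived ?F) scalars ?F"
    using alg_idealD(1) F.central_series_ideal F.second_derived_ideal by blast+
  have J1: "x \<in> ?J" if "x \<in> central_series ?F k" for x
  proof -
    have "x \<oplus>\<^bsub>?F\<^esub> \<zero>\<^bsub>?F\<^esub> \<in> ?J" using that D unfolding F.submodule_iff set_add_def' by blast
    then show ?thesis using that C by (auto simp: F.submodule_iff)
  qed
  have J2: "x \<in> ?J" if "x \<in> second_derived ?F" for x
  proof -
    have "\<zero>\<^bsub>?F\<^esub> \<oplus>\<^bsub>?F\<^esub> x \<in> ?J" using that C unfolding F.submodule_iff set_add_def' by blast
    then show ?thesis using that D by (auto simp: F.submodule_iff)
  qed
  have "(a \<otimes>\<^bsub>?F\<^esub> b) \<otimes>\<^bsub>?F\<^esub> (c \<otimes>\<^bsub>?F\<^esub> d) \<in> ?J"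
    if "a \<in> carrier ?F" "b \<in> carrier ?F" "c \<in> carrier ?F" "d \<in> carrier ?F" for a b c d
  proof (rule J2)
    show "(a \<otimes>\<^bsub>?F\<^esub> b) \<otimes>\<^bsub>?F\<^esub> (c \<otimes>\<^bsub>?F\<^esub> d) \<in> second_derived ?F"
      unfolding second_derived_def derived_def using that by (intro bracket_space_mem)
  qed
  then have "\<forall>a\<in>carrier N. \<forall>b\<in>carrier N. \<forall>c\<in>carrier N. \<forall>d\<in>carrier N.
      (a \<otimes>\<^bsub>N\<^esub> b) \<otimes>\<^bsub>N\<^esub> (c \<otimes>\<^bsub>N\<^esub> d) = \<zero>\<^bsub>N\<^esub>"
    unfolding N quot_forall by (simp add: quot_ops F.prod_closed)
  then show "\<lbrakk>a \<in> carrier N; b \<in> carrier N; c \<in> carrier N; d \<in> carrier N\<rbrakk> \<Longrightarrow>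
      (a \<otimes>\<^bsub>N\<^esub> b) \<otimes>\<^bsub>N\<^esub> (c \<otimes>\<^bsub>N\<^esub> d) = \<zero>\<^bsub>N\<^esub>" by blast
  have mem2: "a \<otimes>\<^bsub>?F\<^esub> (b \<otimes>\<^bsub>?F\<^esub> c) \<in> ?J"
    if "k = 2" "a \<in> carrier ?F" "b \<in> carrier ?F" "c \<in> carrier ?F" for a b c
  proof (rule J1)
    show "a \<otimes>\<^bsub>?F\<^esub> (b \<otimes>\<^bsub>?F\<^esub> c) \<in> central_series ?F k"
      unfolding that(1) numeral_2_eq_2 central_series.simps using that(2-4) by (intro bracket_space_mem)
  qed
  have "\<forall>a\<in>carrier N. \<forall>b\<in>carrier N. \<forall>c\<in>carrier N. a \<otimes>\<^bsub>N\<^esub> (b \<otimes>\<^bsub>N\<^esub> c) = \<zero>\<^bsub>N\<^esub>" if "k = 2"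
    unfolding N quot_forall using mem2[OF that] by (simp add: quot_ops F.prod_closed)
  then show "\<lbrakk>k = 2; a \<in> carrier N; b \<in> carrier N; c \<in> carrier N\<rbrakk> \<Longrightarrow>
      a \<otimes>\<^bsub>N\<^esub> (b \<otimes>\<^bsub>N\<^esub> c) = \<zero>\<^bsub>N\<^esub>" by blast
  have mem3: "a \<otimes>\<^bsub>?F\<^esub> (b \<otimes>\<^bsub>?F\<^esub> (c \<otimes>\<^bsub>?F\<^esub> d)) \<in> ?J"
    if "k = 3" "a \<in> carrier ?F" "b \<in> carrier ?F" "c \<in> carrier ?F" "d \<in> carrier ?F" for a b c d
  proof (rule J1)
    show "a \<otimes>\<^bsub>?F\<^esub> (b \<otimes>\<^bsub>?F\<^esub> (c \<otimes>\<^bsub>?F\<^esub> d)) \<in> central_series ?F k"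
      unfolding that(1) numeral_3_eq_3 central_series.simps using that(2-5) by (intro bracket_space_mem)
  qed
  have "\<forall>a\<in>carrier N. \<forall>b\<in>carrier N. \<forall>c\<in>carrier N. \<forall>d\<in>carrier N.
      a \<otimes>\<^bsub>N\<^esub> (b \<otimes>\<^bsub>N\<^esub> (c \<otimes>\<^bsub>N\<^esub> d)) = \<zero>\<^bsub>N\<^esub>" if "k = 3"
    unfolding N quot_forall using mem3[OF that] by (simp add: quot_ops F.prod_closed)
  then show "\<lbrakk>k = 3; a \<in> carrier N; b \<in> carrier N; c \<in> carrier N; d \<in> carrier N\<rbrakk> \<Longrightarrow>
      a \<otimes>\<^bsub>N\<^esub> (b \<otimes>\<^bsub>N\<^esub> (c \<otimes>\<^bsub>N\<^esub> d)) = \<zero>\<^bsub>N\<^esub>" by blast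
qed


section \<open>Filiform coordinates\<close>

abbreviation unit_vec :: "nat \<Rightarrow> nat \<Rightarrow> 'k::field" where
  "unit_vec i \<equiv> (\<lambda>n. if n = i then 1 else 0)"

text \<open>The model filiform Lie algebra with basis \<open>e_0, ..., e_k\<close>: up to skew
  symmetry, the only nonzero brackets of basis vectors are \<open>[e_0, e_i] = e_(i+1)\<close> for
  \<open>1 \<le> i < k\<close>.\<close>

definition filiform_bracket :: "nat \<Rightarrow> (nat \<Rightarrow> 'k::field) \<Rightarrow> (nat \<Rightarrow> 'k) \<Rightarrow> nat \<Rightarrow> 'k" where
  "filiform_bracket k f g = (\<lambda>n. if 2 \<le> n \<and> n \<le> k then f 0 * g (n - 1) - g 0 * f (n - 1) else 0)"

text \<open>The coordinates beyond \<open>k\<close> are junk; they are assigned degree \<open>1\<close>.\<close>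

lemma graded_bracket_filiform:
  assumes "1 \<le> k"
  shows "graded_bracket (filiform_bracket k :: (nat \<Rightarrow> 'k::field) \<Rightarrow> _) (\<lambda>n. if k < n then 1 else max 1 n) k"
proof
  fix f g :: "nat \<Rightarrow> 'k" and r n :: nat
  assume g: "\<And>n. (if k < n then 1 else max 1 n) \<le> r \<Longrightarrow> g n = 0"
    and n: "(if k < n then 1 else max 1 n) \<le> Suc r"
  show "filiform_bracket k f g n = 0"
  proof (cases "2 \<le> n \<and> n \<le> k")
    case True
    \<comment> \<open>Since \<open>2 \<le> n \<le> Suc r\<close>, the indices \<open>0\<close> and
      \<open>n - 1\<close> both have degree at most \<open>r\<close>.\<close>
    then have "g 0 = 0" "g (n - 1) = 0" using n by (auto intro!: g)
    then show ?thesis by (simp add: filiform_bracket_def)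
  qed (auto simp: filiform_bracket_def)
next
  fix f g h :: "nat \<Rightarrow> 'k" and n :: nat
  show "filiform_bracket k f (filiform_bracket k g h) n + filiform_bracket k g (filiform_bracket k h f) n
      + filiform_bracket k h (filiform_bracket k f g) n = 0"
    by (auto simp: filiform_bracket_def algebra_simps)
next
  fix f g :: "nat \<Rightarrow> 'k"
  assume "\<And>n. (if k < n then 1 else max 1 n) \<le> 1 \<Longrightarrow> f n = 0"
    "\<And>n. (if k < n then 1 else max 1 n) \<le> 1 \<Longrightarrow> g n = 0"
  \<comment> \<open>Index \<open>0\<close> has degree 1, and vectors without
    \<open>e_0\<close>-component commute.\<close>
  from this[of 0] show "filiform_bracket k f g = (\<lambda>n. 0)" by (auto simp: filiform_bracket_def)
qed (use assms in \<open>auto simp: filiform_bracket_def algebra_simps\<close>)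

lemma filiform_bracket_zero:
  "filiform_bracket k (\<lambda>n. 0) g = (\<lambda>n. 0)" "filiform_bracket k f (\<lambda>n. 0) = (\<lambda>n. 0)"
  by (auto simp: filiform_bracket_def)

lemma filiform_power_zero: "(filiform_bracket k f ^^ d) (\<lambda>n. 0) = (\<lambda>n. 0)"
  by (induction d) (simp_all add: filiform_bracket_zero)

lemma filiform_power_unit:
  "Suc d \<le> k \<Longrightarrow> (filiform_bracket k (unit_vec 0) ^^ d) (unit_vec 1) = (unit_vec (Suc d) :: nat \<Rightarrow> 'a::field)"
proof (induction d)
  case (Suc d)
  then have "(filiform_bracket k (unit_vec 0) ^^ Suc d) (unit_vec 1) =
      filiform_bracket k (unit_vec 0) (unit_vec (Suc d) :: nat \<Rightarrow> 'a)" by simp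
  also have "\<dots> = unit_vec (Suc (Suc d))"
    using Suc.prems by (auto simp: filiform_bracket_def fun_eq_iff)
  finally show ?case .
qed simp

text \<open>The image of \<open>ad e_1\<close> has no \<open>e_0\<close>-component, and
  \<open>e_1\<close> commutes with all such vectors.\<close>

lemma filiform_square_unit_one:
  "filiform_bracket k (unit_vec 1) (filiform_bracket k (unit_vec 1) f) = (\<lambda>n. 0)"
  by (auto simp: filiform_bracket_def fun_eq_iff)

text \<open>
  Sending the \<open>i\<close>-th generator to \<open>unit_vec 0\<close>, the \<open>j\<close>-th one to \<open>unit_vec 1\<close> and the others to
  zero singles out \<open>ad\<^sub>i\<^sup>d x\<^sub>j\<close> among the elements \<open>ad\<^sub>p\<^sup>d x\<^sub>q\<close>.
\<close>

lemma filiform_power_coord: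
  fixes p q i j d k :: nat
  defines "g \<equiv> \<lambda>l. if l = i then unit_vec 0 else if l = j then unit_vec 1 else (\<lambda>n. 0 :: 'k::field)"
  assumes d: "1 \<le> d" "d < k" and "p \<noteq> q" "i \<noteq> j" and ord: "d = 1 \<Longrightarrow> p < q \<and> i < j"
  shows "(filiform_bracket k (g p) ^^ d) (g q) (Suc d) = (if (p, q) = (i, j) then 1 else 0)"
proof -
  obtain e where e: "d = Suc e" using d by (cases d) auto
  \<comment> \<open>Only the first case gives 1. In the third case \<open>g q\<close> is zero, in
    the fourth \<open>g p\<close>.\<close>
  consider "p = i" "q = j" | "p = j" "q = i" | "p = i \<or> p = j" "q \<noteq> i" "q \<noteq> j" | "p \<noteq> i" "p \<noteq> j"
    using \<open>p \<noteq> q\<close> by blast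
  then show ?thesis
  proof cases
    case 1
    then have "g p = unit_vec 0" "g q = unit_vec 1" using \<open>i \<noteq> j\<close> by (simp_all add: g_def)
    then have "(filiform_bracket k (g p) ^^ d) (g q) = unit_vec (Suc d)"
      using d by (simp only: filiform_power_unit Suc_le_eq)
    then show ?thesis using 1 by simp
  next
    case 2
    \<comment> \<open>The ordering excludes the swapped pair for \<open>d = 1\<close>; for
      \<open>d \<ge> 2\<close> it is killed by \<open>(ad e_1)^2 = 0\<close>.\<close>
    have "e \<noteq> 0"
    proof
      assume "e = 0"
      then show False using ord e 2 by auto
    qed
    then obtain e' where "d = Suc (Suc e')" using e by (cases e) auto
    moreover have "g p = unit_vec 1" using 2 \<open>i \<noteq> j\<close> by (simp add: g_def)
    ultimately have "(filiform_bracket k (g p) ^^ d) (g q) = (\<lambda>n. 0)"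
      by (simp only: funpow.simps comp_apply filiform_square_unit_one)
    then show ?thesis using 2 \<open>i \<noteq> j\<close> by simp
  next
    case 3
    then show ?thesis by (auto simp: g_def filiform_power_zero)
  next
    case 4
    then show ?thesis by (simp add: g_def e filiform_bracket_zero)
  qed
qed

section \<open>Powers of ad and their coordinates\<close>

lemma (in nonassoc_algebra) ad_power_closed:
  "\<lbrakk>x \<in> carrier A; y \<in> carrier A\<rbrakk> \<Longrightarrow> ((\<otimes>) x ^^ d) y \<in> carrier A"
  by (induction d) (simp_all add: prod_closed)

lemma (in nonassoc_algebra) coord_hom_ad_power:
  assumes "coord_hom A br h" "x \<in> carrier A" "y \<in> carrier A"
  shows "h (((\<otimes>) x ^^ d) y) = (br (h x) ^^ d) (h y)"
  using assms by (induction d) (simp_all add: coord_homD(3)[OF assms(1)] ad_power_closed)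

lemma fmn_filiform_coord:
  fixes m k i j d :: nat and N :: "('k::field, (nat magma \<Rightarrow> 'k) set set) module"
  defines "N \<equiv> free_metabelian_nilpotent m k"
  assumes "1 \<le> d" "d < k" "i \<noteq> j" "d = 1 \<Longrightarrow> i < j"
  shows "\<exists>h. coord_hom N (filiform_bracket k) h \<and>
    (\<forall>p<m. \<forall>q<m. p \<noteq> q \<and> (d = 1 \<longrightarrow> p < q) \<longrightarrow>
      h (((\<otimes>\<^bsub>N\<^esub>) (fmn_gen m k p) ^^ d) (fmn_gen m k q)) (Suc d) = (if (p, q) = (i, j) then 1 else 0))"
proof -
  interpret N: lie_algebra N unfolding N_def by (rule lie_algebra_free_metabelian_nilpotent)
  interpret graded_bracket "filiform_bracket k :: (nat \<Rightarrow> 'k) \<Rightarrow> _" "\<lambda>n. if k < n then 1 else max 1 n" k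
    by (rule graded_bracket_filiform) (use assms in simp)
  obtain h where h: "coord_hom N (filiform_bracket k) h"
    "\<And>l. l < m \<Longrightarrow> h (fmn_gen m k l) =
       (if l = i then unit_vec 0 else if l = j then unit_vec 1 else (\<lambda>n. 0))"
    unfolding N_def
    using coord_hom_fmn[where m = m and
          g = "\<lambda>l. if l = i then unit_vec 0 else if l = j then unit_vec 1 else (\<lambda>n. 0)"] by blast
  show ?thesis
  proof (intro exI conjI allI impI; (elim conjE)?)
    show "coord_hom N (filiform_bracket k) h" by (rule h(1))
    fix p q assume pq: "p < m" "q < m" "p \<noteq> q" "d = 1 \<longrightarrow> p < q"
    then have "fmn_gen m k p \<in> carrier N" "fmn_gen m k q \<in> carrier N"
      by (simp_all add: N_def fmn_gen_closed)
    then have "h (((\<otimes>\<^bsub>N\<^esub>) (fmn_gen m k p) ^^ d) (fmn_gen m k q)) =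
        (filiform_bracket k (h (fmn_gen m k p)) ^^ d) (h (fmn_gen m k q))"
      by (rule N.coord_hom_ad_power[OF h(1)])
    then show "h (((\<otimes>\<^bsub>N\<^esub>) (fmn_gen m k p) ^^ d) (fmn_gen m k q)) (Suc d) =
        (if (p, q) = (i, j) then 1 else 0)"
      using filiform_power_coord[of d k p q i j] assms pq by (simp only: h(2)) blast
  qed
qed


section \<open>Necessity\<close>

context ad_invariant_metric
begin

lemma form_zero_left: "y \<in> carrier L \<Longrightarrow> form \<zero> y = 0"
  using form_smult_left[of \<zero> y 0] by simp

lemma form_zero_right: "x \<in> carrier L \<Longrightarrow> form x \<zero> = 0"
  using form_smult_right[of x \<zero> 0] by simp

lemma form_assoc:
  assumes "x \<in> carrier L" "y \<in> carrier L" "z \<in> carrier L"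
  shows "form (x \<otimes> y) z = form x (y \<otimes> z)"
proof -
  have "form (x \<otimes> y) z = - form (y \<otimes> x) z"
    using assms skew[of x y] by (simp add: form_smult_left prod_closed)
  also have "\<dots> = form x (y \<otimes> z)"
    using form_ad_invariant[OF assms(2,1,3)] by (simp add: add_eq_0_iff)
  finally show ?thesis .
qed

lemma form_central:
  assumes "z \<in> carrier L" "a \<in> carrier L" "b \<in> carrier L" "a \<otimes> z = \<zero>"
  shows "form z (a \<otimes> b) = 0"
  using form_ad_invariant[of a z b] assms by (simp add: form_zero_left)

lemma form_finsum_left:
  assumes "finite P" "\<And>p. p \<in> P \<Longrightarrow> v p \<in> carrier L" "y \<in> carrier L"
  shows "form (\<Oplus>p\<in>P. c p \<odot> v p) y = (\<Sum>p\<in>P. c p * form (v p) y)"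
  using assms(1,2)
proof (induction P)
  case empty
  then show ?case using assms(3) by (simp add: form_zero_left)
next
  case (insert p P)
  then have "(\<lambda>p. c p \<odot> v p) \<in> P \<rightarrow> carrier L" by auto
  then show ?case using insert assms(3) by (simp add: form_add_left form_smult_left)
qed

text \<open>The orthogonal space of \<open>z\<close> contains all brackets, so it is a subalgebra;
  containing \<open>G\<close>, it is everything.\<close>

lemma eq_zero_if_orthogonal:
  assumes gen: "generates L G" and z: "z \<in> carrier L" and G: "\<And>g. g \<in> G \<Longrightarrow> form z g = 0"
    and brackets: "\<And>a b. \<lbrakk>a \<in> carrier L; b \<in> carrier L\<rbrakk> \<Longrightarrow> form z (a \<otimes> b) = 0"
  shows "z = \<zero>"
proof -
  let ?H = "{y \<in> carrier L. form z y = 0}"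
  have "submodule ?H scalars L"
    unfolding submodule_iff using z by (auto simp: form_zero_right form_add_right form_smult_right)
  moreover have "x \<otimes> y \<in> ?H" if "x \<in> ?H" "y \<in> ?H" for x y
    using that brackets by (simp add: prod_closed)
  moreover have "G \<subseteq> ?H" using G generatesD(1)[OF gen] by auto
  ultimately have "carrier L \<subseteq> ?H" by (rule generatesD(2)[OF gen])
  then show ?thesis using form_nondegenerate[OF z] by auto
qed

text \<open>The form pairs \<open>[L, L']\<close> trivially with \<open>L'\<close>, so \<open>[L, L']\<close> is central.\<close>

lemma metabelian_step:
  assumes metabelian: "\<And>a b c d. \<lbrakk>a \<in> carrier L; b \<in> carrier L; c \<in> carrier L; d \<in> carrier L\<rbrakk> \<Longrightarrow>
      (a \<otimes> b) \<otimes> (c \<otimes> d) = \<zero>"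
    and "a \<in> carrier L" "b \<in> carrier L" "c \<in> carrier L" "d \<in> carrier L"
  shows "a \<otimes> (b \<otimes> (c \<otimes> d)) = \<zero>"
proof (rule form_nondegenerate)
  show "\<forall>y\<in>carrier L. form (a \<otimes> (b \<otimes> (c \<otimes> d))) y = 0"
  proof
    fix y assume "y \<in> carrier L"
    \<comment> \<open>By \<open>form_assoc\<close> the value is
      \<open>form b ((c \<otimes> d) \<otimes> (a \<otimes> y))\<close>, and the inner bracket
      vanishes by the metabelian law.\<close>
    then have "form (b \<otimes> (c \<otimes> d)) (a \<otimes> y) = 0"
      using assms by (simp add: form_assoc prod_closed form_zero_right)
    then show "form (a \<otimes> (b \<otimes> (c \<otimes> d))) y = 0"
      using form_ad_invariant[of a "b \<otimes> (c \<otimes> d)" y] assms \<open>y \<in> carrier L\<close> by (simp add: prod_closed)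
  qed
qed (use assms in \<open>simp add: prod_closed\<close>)

text \<open>
  A central element is orthogonal to the derived algebra, hence determined by its pairings with
  the generators.
\<close>

lemma central_relation:
  assumes gen: "generates L (x ` {..<m})" and P: "finite P" "m < card P"
    and v: "\<And>p. p \<in> P \<Longrightarrow> v p \<in> carrier L"
    and central: "\<And>p a. \<lbrakk>p \<in> P; a \<in> carrier L\<rbrakk> \<Longrightarrow> a \<otimes> v p = \<zero>"
  shows "\<exists>c. (\<exists>p\<in>P. c p \<noteq> 0) \<and> (\<Oplus>p\<in>P. c p \<odot> v p) = \<zero>"
proof -
  \<comment> \<open>One equation per generator, one unknown per element of \<open>P\<close>.\<close>
  obtain c where c: "\<exists>p\<in>P. c p \<noteq> 0" "\<And>i. i < m \<Longrightarrow> (\<Sum>p\<in>P. c p * form (v p) (x i)) = 0"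
    using underdetermined_system[OF P, of "\<lambda>p i. form (v p) (x i)"] by blast
  have "(\<Oplus>p\<in>P. c p \<odot> v p) = \<zero>"
  proof (rule eq_zero_if_orthogonal[OF gen])
    show "(\<Oplus>p\<in>P. c p \<odot> v p) \<in> carrier L" using v by (intro M.finsum_closed) auto
  next
    fix g assume "g \<in> x ` {..<m}"
    then show "form (\<Oplus>p\<in>P. c p \<odot> v p) g = 0"
      using c generatesD(1)[OF gen] by (auto simp: form_finsum_left[OF P(1) v])
  next
    fix a b assume "a \<in> carrier L" "b \<in> carrier L"
    then show "form (\<Oplus>p\<in>P. c p \<odot> v p) (a \<otimes> b) = 0"
      by (simp add: form_finsum_left[OF P(1) v] prod_closed form_central v central)
  qed
  with c(1) show ?thesis by blast
qed

end

text \<open>The elements \<open>ad_p^(k-1) x_q\<close> for \<open>(p, q)\<close> in \<open>P\<close>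
  are central because \<open>C^k\<close> vanishes in \<open>N\<close>. Being more than
  \<open>m\<close>, they satisfy a nontrivial linear relation, against their independence.\<close>

lemma no_fmn_metric_if_many:
  fixes m k :: nat and N :: "('k::field, (nat magma \<Rightarrow> 'k) set set) module"
  defines "N \<equiv> free_metabelian_nilpotent m k"
  assumes metric: "ad_invariant_metric N form" and k: "k = 2 \<or> k = 3"
    and P: "finite P" "m < card P"
    and pairs: "\<And>p q. (p, q) \<in> P \<Longrightarrow> p < m \<and> q < m \<and> p \<noteq> q \<and> (k = 2 \<longrightarrow> p < q)"
  shows False
proof -
  interpret ad_invariant_metric N form by (rule metric)
  let ?x = "fmn_gen m k :: nat \<Rightarrow> (nat magma \<Rightarrow> 'k) set set"
  define v where "v = (\<lambda>(p, q). ((\<otimes>\<^bsub>N\<^esub>) (?x p) ^^ (k - 1)) (?x q))"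
  have x: "?x p \<in> carrier N" "?x q \<in> carrier N" if "(p, q) \<in> P" for p q
    using pairs[OF that] by (simp_all add: N_def fmn_gen_closed)
  have v: "v p \<in> carrier N" if "p \<in> P" for p
    using that x by (cases p) (simp add: v_def ad_power_closed)
  have central: "a \<otimes>\<^bsub>N\<^esub> v p = \<zero>\<^bsub>N\<^esub>" if "p \<in> P" "a \<in> carrier N" for p a
  proof -
    obtain i j where p: "p = (i, j)" by (cases p)
    then have xij: "?x i \<in> carrier N" "?x j \<in> carrier N" using that x by auto
    from k show ?thesis
    proof
      assume "k = 2"
      then have "v p = ?x i \<otimes>\<^bsub>N\<^esub> ?x j" by (simp add: v_def p)
      then show ?thesis
        using fmn_nilpotent_2[OF \<open>k = 2\<close>] that(2) xij unfolding N_def by metis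
    next
      assume "k = 3"
      then have "v p = ?x i \<otimes>\<^bsub>N\<^esub> (?x i \<otimes>\<^bsub>N\<^esub> ?x j)" by (simp add: v_def p numeral_2_eq_2)
      then show ?thesis
        using fmn_nilpotent_3[OF \<open>k = 3\<close>] that(2) xij unfolding N_def by metis
    qed
  qed
  have gen: "generates N (?x ` {..<m})" unfolding N_def by (rule generates_fmn)
  have "\<exists>c. (\<exists>p\<in>P. c p \<noteq> 0) \<and> (\<Oplus>\<^bsub>N\<^esub>p\<in>P. c p \<odot>\<^bsub>N\<^esub> v p) = \<zero>\<^bsub>N\<^esub>"
    by (rule central_relation[OF gen P]) (use v central in auto)
  then obtain c p where c: "p \<in> P" "c p \<noteq> 0" "(\<Oplus>\<^bsub>N\<^esub>p\<in>P. c p \<odot>\<^bsub>N\<^esub> v p) = \<zero>\<^bsub>N\<^esub>"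
    by blast
  obtain i j where p: "p = (i, j)" by (cases p)
  have ij: "i < m" "j < m" "i \<noteq> j" "k = 2 \<Longrightarrow> i < j" using pairs c(1) p by blast+
  have d: "Suc (k - 1) = k" "1 \<le> k - 1" "k - 1 < k" "k - 1 = 1 \<longleftrightarrow> k = 2" using k by auto
  obtain h where h: "coord_hom N (filiform_bracket k) h"
    "\<And>p q. \<lbrakk>p < m; q < m; p \<noteq> q \<and> (k - 1 = 1 \<longrightarrow> p < q)\<rbrakk> \<Longrightarrow>
      h (((\<otimes>\<^bsub>N\<^esub>) (?x p) ^^ (k - 1)) (?x q)) (Suc (k - 1)) = (if (p, q) = (i, j) then 1 else 0)"
    using fmn_filiform_coord[OF d(2,3) ij(3), of m] ij(4) d(4) unfolding N_def by blast
  have hv: "h (v p') k = (if p' = p then 1 else 0)" if "p' \<in> P" for p'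
  proof -
    obtain q r where p': "p' = (q, r)" by (cases p')
    then have "q < m" "r < m" "q \<noteq> r \<and> (k - 1 = 1 \<longrightarrow> q < r)" using pairs that d(4) by blast+
    from h(2)[OF this] show ?thesis unfolding d(1) by (simp add: p p' v_def)
  qed
  \<comment> \<open>Coordinate \<open>k\<close> of \<open>h\<close> reads off the coefficient
    \<open>c p\<close> of the relation, chosen nonzero.\<close>
  have "0 = h (\<Oplus>\<^bsub>N\<^esub>p\<in>P. c p \<odot>\<^bsub>N\<^esub> v p) k" using c(3) by (simp add: coord_hom_zero[OF h(1)])
  also have "\<dots> = (\<Sum>p'\<in>P. c p' * h (v p') k)"
    using v by (simp add: coord_hom_finsum[OF h(1) P(1)] coord_homD(2)[OF h(1)])
  also have "\<dots> = (\<Sum>p'\<in>P. if p' = p then c p' else 0)" using hv by (intro sum.cong) auto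
  also have "\<dots> = c p" using P(1) c(1) by simp
  finally show False using c(2) by simp
qed

lemma fmn_metric_necessary:
  fixes m k :: nat and N :: "('k::field, (nat magma \<Rightarrow> 'k) set set) module"
  defines "N \<equiv> free_metabelian_nilpotent m k"
  assumes mk: "2 \<le> m" "2 \<le> k" and metric: "ad_invariant_metric N form"
  shows "(m, k) = (3, 2) \<or> (m, k) = (2, 3)"
proof -
  interpret ad_invariant_metric N form by (rule metric)
  let ?x = "fmn_gen m k :: nat \<Rightarrow> (nat magma \<Rightarrow> 'k) set set"
  have x: "?x 0 \<in> carrier N" "?x 1 \<in> carrier N" using mk by (simp_all add: N_def fmn_gen_closed)
  have nonzero: "((\<otimes>\<^bsub>N\<^esub>) (?x 0) ^^ d) (?x 1) \<noteq> \<zero>\<^bsub>N\<^esub>" if d: "1 \<le> d" "d < k" for d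
  proof
    assume *: "((\<otimes>\<^bsub>N\<^esub>) (?x 0) ^^ d) (?x 1) = \<zero>\<^bsub>N\<^esub>"
    obtain h where h: "coord_hom N (filiform_bracket k) h"
      "\<And>p q. \<lbrakk>p < m; q < m; p \<noteq> q \<and> (d = 1 \<longrightarrow> p < q)\<rbrakk> \<Longrightarrow>
        h (((\<otimes>\<^bsub>N\<^esub>) (?x p) ^^ d) (?x q)) (Suc d) = (if (p, q) = (0, 1) then 1 else 0)"
      using fmn_filiform_coord[of d k 0 1 m] d unfolding N_def by (metis zero_neq_one zero_less_one)
    show False using h(2)[of 0 1] mk * by (simp add: coord_hom_zero[OF h(1)])
  qed
  have "k \<le> 3"
  proof (rule ccontr)
    assume "\<not> k \<le> 3"
    then have "((\<otimes>\<^bsub>N\<^esub>) (?x 0) ^^ 3) (?x 1) \<noteq> \<zero>\<^bsub>N\<^esub>" by (intro nonzero) auto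
    \<comment> \<open>A metric forces \<open>ad_0^3 x_1 = 0\<close>, while this element survives for
      \<open>k \<ge> 4\<close>.\<close>
    moreover have "?x 0 \<otimes>\<^bsub>N\<^esub> (?x 0 \<otimes>\<^bsub>N\<^esub> (?x 0 \<otimes>\<^bsub>N\<^esub> ?x 1)) = \<zero>\<^bsub>N\<^esub>"
      by (rule metabelian_step) (use x in \<open>simp_all add: N_def fmn_metabelian\<close>)
    ultimately show False by (simp add: numeral_3_eq_3)
  qed
  then have k: "k = 2 \<or> k = 3" using mk by auto
  have card: "card (Pair (0::nat) ` A \<union> Pair 1 ` B) = card A + card B" if "finite A" "finite B" for A B :: "nat set"
    using that by (subst card_Un_disjoint) (auto simp: card_image inj_on_def)
  have False if "k = 3" "3 \<le> m"
  proof (rule no_fmn_metric_if_many)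
    \<comment> \<open>The pairs \<open>(0, q)\<close> and \<open>(1, q)\<close> with distinct
      entries number \<open>2 * m - 2\<close>, which exceeds \<open>m\<close> as
      \<open>m \<ge> 3\<close>.\<close>
    show "m < card (Pair 0 ` {1..<m} \<union> Pair (1::nat) ` ({..<m} - {1}))"
      using that by (subst card) auto
  qed (use that metric in \<open>auto simp: N_def\<close>)
  moreover have False if "k = 2" "4 \<le> m"
  proof (rule no_fmn_metric_if_many)
    \<comment> \<open>Under the restriction \<open>p < q\<close> there are \<open>2 * m - 3\<close>
      such pairs, which exceeds \<open>m\<close> as \<open>m \<ge> 4\<close>.\<close>
    show "m < card (Pair 0 ` {1..<m} \<union> Pair (1::nat) ` {2..<m})"
      using that by (subst card) auto
  qed (use that metric in \<open>auto simp: N_def\<close>)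
  \<comment> \<open>Counting cannot work with the single pair \<open>(0, 1)\<close>. Instead,
    invariance rewrites the pairing of \<open>[x_0, x_1]\<close> with either generator so that
    \<open>[x_0, x_0]\<close> or \<open>[x_1, x_1]\<close> appears.\<close>
  moreover have False if "k = 2" "m = 2"
  proof -
    have c: "a \<otimes>\<^bsub>N\<^esub> (?x 0 \<otimes>\<^bsub>N\<^esub> ?x 1) = \<zero>\<^bsub>N\<^esub>" if "a \<in> carrier N" for a
      using that x \<open>k = 2\<close> fmn_nilpotent_2[of k a m "?x 0" "?x 1"] by (simp add: N_def)
    have "?x 0 \<otimes>\<^bsub>N\<^esub> ?x 1 = \<zero>\<^bsub>N\<^esub>"
    proof (rule eq_zero_if_orthogonal)
      show "generates N (?x ` {..<m})" unfolding N_def by (rule generates_fmn)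
      fix g assume "g \<in> ?x ` {..<m}"
      then consider "g = ?x 0" | "g = ?x 1" using \<open>m = 2\<close> by (auto simp: less_2_cases_iff)
      then show "form (?x 0 \<otimes>\<^bsub>N\<^esub> ?x 1) g = 0"
      proof cases
        case 1
        have "form (?x 0 \<otimes>\<^bsub>N\<^esub> ?x 1) (?x 0) = form (?x 0) (?x 0 \<otimes>\<^bsub>N\<^esub> ?x 1)"
          using x by (intro form_sym prod_closed)
        also have "\<dots> = 0" using x form_assoc[of "?x 0" "?x 0" "?x 1"]
          by (simp add: alternating form_zero_left)
        finally show ?thesis using 1 by simp
      next
        case 2
        then show ?thesis using x by (simp add: form_assoc alternating form_zero_right)
      qed
    qed (use x c form_central in \<open>auto simp: prod_closed\<close>)
    then show False using nonzero[of 1] \<open>k = 2\<close> by simp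
  qed
  ultimately show ?thesis using k mk by (cases "m = 2"; cases "m = 3") auto
qed


section \<open>Sufficiency\<close>

text \<open>By bilinearity the span of \<open>S\<close> is closed under products, hence a subalgebra
  containing the generators. Closure is extended first in the right factor, then in the
  left.\<close>

lemma (in nonassoc_algebra) carrier_subset_span:
  assumes gen: "generates A G" and S: "S \<subseteq> carrier A" "G \<subseteq> S"
    and prod: "\<And>s t. \<lbrakk>s \<in> S; t \<in> S\<rbrakk> \<Longrightarrow> s \<otimes> t \<in> lin_span A S"
  shows "carrier A \<subseteq> lin_span A S"
proof (rule generatesD(2)[OF gen])
  show sub: "submodule (lin_span A S) scalars A" using S(1) by (rule lin_span_submodule)
  have H: "\<zero> \<in> lin_span A S" "\<And>u v. \<lbrakk>u \<in> lin_span A S; v \<in> lin_span A S\<rbrakk> \<Longrightarrow> u \<oplus> v \<in> lin_span A S"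
    "\<And>c u. u \<in> lin_span A S \<Longrightarrow> c \<odot> u \<in> lin_span A S" and H': "lin_span A S \<subseteq> carrier A"
    using sub unfolding submodule_iff by blast+
  have zero: "x \<otimes> \<zero> = \<zero>" "\<zero> \<otimes> x = \<zero>" if "x \<in> carrier A" for x
    using that prod_smult_left[of \<zero> x 0] prod_smult_right[of x \<zero> 0] by (simp_all add: prod_closed)
  have left: "lin_span A S \<subseteq> {y \<in> carrier A. s \<otimes> y \<in> lin_span A S}" if "s \<in> S" for s
  proof (rule lin_span_least)
    have "s \<in> carrier A" using that S by blast
    then show "submodule {y \<in> carrier A. s \<otimes> y \<in> lin_span A S} scalars A"
      unfolding submodule_iff using H by (auto simp: zero prod_add_right prod_smult_right)
  qed (use that S prod in auto)
  fix x y assume xy: "x \<in> lin_span A S" "y \<in> lin_span A S"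
  then have y: "y \<in> carrier A" using H' by blast
  have "lin_span A S \<subseteq> {x \<in> carrier A. x \<otimes> y \<in> lin_span A S}"
  proof (rule lin_span_least)
    show "submodule {x \<in> carrier A. x \<otimes> y \<in> lin_span A S} scalars A"
      unfolding submodule_iff using H y by (auto simp: zero prod_add_left prod_smult_left)
  qed (use left xy S in auto)
  then show "x \<otimes> y \<in> lin_span A S" using xy by blast
qed (use S lin_span_superset in blast)

text \<open>The \<open>v i\<close> span by the multiplication table and are independent by
  \<open>hv\<close>, so \<open>h\<close> is injective and \<open>B\<close> can be pulled back.
  Nondegeneracy of \<open>B\<close> concerns only the first \<open>n\<close> coordinates, because
  vectors are functions on all of \<open>nat\<close>.\<close>

lemma (in lie_algebra) metric_of_coordinates:
  fixes h :: "'a \<Rightarrow> nat \<Rightarrow> 'k" and v :: "nat \<Rightarrow> 'a" and B :: "(nat \<Rightarrow> 'k) \<Rightarrow> (nat \<Rightarrow> 'k) \<Rightarrow> 'k"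
  assumes h: "coord_hom L br h" and gen: "generates L G" and Gv: "G \<subseteq> v ` {..<n}"
    and v: "\<And>i. i < n \<Longrightarrow> v i \<in> carrier L"
    and prod: "\<And>i j. \<lbrakk>i < j; j < n\<rbrakk> \<Longrightarrow> v i \<otimes> v j \<in> lin_span L (v ` {..<n})"
    and hv: "\<And>i. i < n \<Longrightarrow> h (v i) = unit_vec i"
    and B_add: "\<And>f f' g. B (\<lambda>n. f n + f' n) g = B f g + B f' g"
    and B_smult: "\<And>c f g. B (\<lambda>n. c * f n) g = c * B f g"
    and B_sym: "\<And>f g. B f g = B g f"
    and B_invariant: "\<And>f g g'. B (br f g) g' + B g (br f g') = 0"
    and B_nondegenerate: "\<And>f i. \<lbrakk>\<And>j. j < n \<Longrightarrow> B f (unit_vec j) = 0; i < n\<rbrakk> \<Longrightarrow> f i = 0"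
  shows "ad_invariant_metric L (\<lambda>x y. B (h x) (h y))"
proof -
  let ?S = "v ` {..<n}"
  have S: "?S \<subseteq> carrier L" using v by auto
  have sub: "submodule (lin_span L ?S) scalars L" using S by (rule lin_span_submodule)
  have "v i \<otimes> v j \<in> lin_span L ?S" if "i < n" "j < n" for i j
  proof (rule linorder_cases[of i j])
    assume "i = j"
    then show ?thesis using that v sub by (simp add: alternating submodule_iff)
  next
    assume "j < i"
    then have "(-1) \<odot> (v j \<otimes> v i) \<in> lin_span L ?S" using that prod sub by (simp add: submodule_iff)
    then show ?thesis using skew[of "v i" "v j"] v that by simp
  qed (use that prod in blast)
  then have span: "carrier L \<subseteq> lin_span L ?S" by (intro carrier_subset_span[OF gen S Gv]) auto
  \<comment> \<open>Elements equal to their own expansion in the \<open>v i\<close> form a subspace;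
    it contains each \<open>v j\<close>, hence the whole span.\<close>
  let ?H = "{x \<in> carrier L. x = (\<Oplus>i\<in>{..<n}. h x i \<odot> v i)}"
  have vc: "(\<lambda>i. c i \<odot> v i) \<in> {..<n} \<rightarrow> carrier L" for c using v by auto
  have "submodule ?H scalars L"
    unfolding submodule_iff
  proof (intro conjI ballI allI)
    have "(\<Oplus>i\<in>{..<n}. 0 \<odot> v i) = \<zero>" using v by (intro M.add.finprod_one_eqI) simp
    then show "\<zero> \<in> ?H" by (simp add: coord_hom_zero[OF h])
  next
    fix x y assume xy: "x \<in> ?H" "y \<in> ?H"
    have "(\<Oplus>i\<in>{..<n}. h (x \<oplus> y) i \<odot> v i) = (\<Oplus>i\<in>{..<n}. h x i \<odot> v i \<oplus> h y i \<odot> v i)"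
      using xy v by (intro M.finsum_cong') (auto simp: coord_homD[OF h] smult_distribs)
    also have "\<dots> = x \<oplus> y" using xy by (subst M.finsum_addf[OF vc vc]) auto
    finally show "x \<oplus> y \<in> ?H" using xy by auto
  next
    fix c x assume x: "x \<in> ?H"
    have "(\<Oplus>i\<in>{..<n}. h (c \<odot> x) i \<odot> v i) = (\<Oplus>i\<in>{..<n}. c \<odot> (h x i \<odot> v i))"
      using x v by (intro M.finsum_cong') (auto simp: coord_homD[OF h] smult_distribs)
    also have "\<dots> = c \<odot> (\<Oplus>i\<in>{..<n}. h x i \<odot> v i)"
      using finsum_smult_ldistr[of "{..<n}" c "\<lambda>i. h x i \<odot> v i"] vc by simp
    also have "\<dots> = c \<odot> x" using x by auto
    finally show "c \<odot> x \<in> ?H" using x by auto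
  qed auto
  moreover have "v j \<in> ?H" if j: "j < n" for j
  proof -
    have "(\<Oplus>i\<in>{..<n}. h (v j) i \<odot> v i) = (\<Oplus>i\<in>{..<n}. if j = i then v i else \<zero>)"
      using v j by (intro M.finsum_cong') (auto simp: hv)
    also have "\<dots> = v j" using v j by (intro M.finsum_singleton) auto
    finally show ?thesis using v j by simp
  qed
  ultimately have "lin_span L ?S \<subseteq> ?H" by (intro lin_span_least) auto
  then have expand: "x = (\<Oplus>i\<in>{..<n}. h x i \<odot> v i)" if "x \<in> carrier L" for x
    using that span by blast
  show ?thesis
  proof (intro ad_invariant_metric.intro ad_invariant_metric_axioms.intro lie_algebra_axioms)
    fix x assume x: "x \<in> carrier L" and orth: "\<forall>y\<in>carrier L. B (h x) (h y) = 0"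
    have "B (h x) (unit_vec j) = 0" if "j < n" for j
      using orth v[OF that] hv[OF that] by metis
    then have "h x i = 0" if "i < n" for i using that by (rule B_nondegenerate)
    then have "(\<Oplus>i\<in>{..<n}. h x i \<odot> v i) = \<zero>" using v by (intro M.add.finprod_one_eqI) simp
    then show "x = \<zero>" using expand[OF x] by simp
  next
    fix x y z assume "x \<in> carrier L" "y \<in> carrier L" "z \<in> carrier L"
    then show "B (h x) (h (y \<oplus> z)) = B (h x) (h y) + B (h x) (h z)"
      by (simp add: coord_homD[OF h] B_sym[of "h x"] B_add)
  next
    fix x y c assume "x \<in> carrier L" "y \<in> carrier L"
    then show "B (h x) (h (c \<odot> y)) = c * B (h x) (h y)"
      by (simp add: coord_homD[OF h] B_sym[of "h x"] B_smult)
  next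
    show "B (h x) (h y) = B (h y) (h x)" for x y by (rule B_sym)
  qed (simp_all add: coord_homD[OF h] B_add B_smult B_invariant)
qed

text \<open>
  Coordinates with respect to \<open>x\<^sub>0, x\<^sub>1, x\<^sub>2, [x\<^sub>1, x\<^sub>2], [x\<^sub>2, x\<^sub>0], [x\<^sub>0, x\<^sub>1]\<close>: the bracket of
  \<open>(a, b)\<close> and \<open>(c, d)\<close> is the cross product \<open>(0, a \<times> c)\<close>, and the metric is \<open>a \<bullet> d + b \<bullet> c\<close>.
\<close>

definition cross_bracket :: "(nat \<Rightarrow> 'k::field) \<Rightarrow> (nat \<Rightarrow> 'k) \<Rightarrow> nat \<Rightarrow> 'k" where
  "cross_bracket f g = (\<lambda>n. if n = 3 then f 1 * g 2 - f 2 * g 1 else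
     if n = 4 then f 2 * g 0 - f 0 * g 2 else if n = 5 then f 0 * g 1 - f 1 * g 0 else 0)"

text \<open>The bracket reads only coordinates 0, 1, 2 and writes only 3, 4, 5, so double brackets
  vanish. Junk coordinates beyond 5 get degree 1.\<close>

lemma graded_bracket_cross:
  "graded_bracket (cross_bracket :: (nat \<Rightarrow> 'k::field) \<Rightarrow> _) (\<lambda>n. if n \<in> {3, 4, 5} then 2 else 1) 2"
proof
  fix f g :: "nat \<Rightarrow> 'k" and r n :: nat
  assume g: "\<And>n. (if n \<in> {3, 4, 5} then 2 else 1) \<le> r \<Longrightarrow> g n = 0"
    and n: "(if n \<in> {3, 4, 5} then 2 else 1) \<le> Suc r"
  then show "cross_bracket f g n = 0"
    using g[of 0] g[of 1] g[of 2] by (auto simp: cross_bracket_def split: if_splits)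
next
  fix f g :: "nat \<Rightarrow> 'k"
  assume f: "\<And>n. (if n \<in> {3, 4, 5} then 2 else 1) \<le> (1::nat) \<Longrightarrow> f n = 0"
  show "cross_bracket f g = (\<lambda>n. 0)"
    using f[of 0] f[of 1] f[of 2] by (auto simp: cross_bracket_def)
qed (auto simp: cross_bracket_def algebra_simps)

text \<open>Invariance of the form is the alternation of the scalar triple product.\<close>

lemma fmn_metric_3_2:
  "\<exists>form. ad_invariant_metric
     (free_metabelian_nilpotent 3 2 :: ('k::field, (nat magma \<Rightarrow> 'k) set set) module) form"
proof -
  let ?N = "free_metabelian_nilpotent 3 2 :: ('k, (nat magma \<Rightarrow> 'k) set set) module"
  let ?x = "fmn_gen 3 2 :: nat \<Rightarrow> (nat magma \<Rightarrow> 'k) set set"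
  interpret N: lie_algebra ?N by (rule lie_algebra_free_metabelian_nilpotent)
  interpret graded_bracket "cross_bracket :: (nat \<Rightarrow> 'k) \<Rightarrow> _" "\<lambda>n. if n \<in> {3, 4, 5} then 2 else 1" 2
    by (rule graded_bracket_cross)
  obtain h where h: "coord_hom ?N cross_bracket h" "\<And>i. i < 3 \<Longrightarrow> h (?x i) = unit_vec i"
    using coord_hom_fmn[where m = 3 and g = unit_vec] by blast
  have x: "?x 0 \<in> carrier ?N" "?x 1 \<in> carrier ?N" "?x 2 \<in> carrier ?N" by (simp_all add: fmn_gen_closed)
  define v where "v i = [?x 0, ?x 1, ?x 2, ?x 1 \<otimes>\<^bsub>?N\<^esub> ?x 2, ?x 2 \<otimes>\<^bsub>?N\<^esub> ?x 0, ?x 0 \<otimes>\<^bsub>?N\<^esub> ?x 1] ! i" for i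
  have v_simps: "v 0 = ?x 0" "v 1 = ?x 1" "v (Suc 0) = ?x 1" "v 2 = ?x 2" "v 3 = ?x 1 \<otimes>\<^bsub>?N\<^esub> ?x 2"
      "v 4 = ?x 2 \<otimes>\<^bsub>?N\<^esub> ?x 0" "v 5 = ?x 0 \<otimes>\<^bsub>?N\<^esub> ?x 1"
    by (simp_all add: v_def)
  have less_6: "i = 0 \<or> i = 1 \<or> i = 2 \<or> i = 3 \<or> i = 4 \<or> i = 5" if "i < 6" for i :: nat
    using that by auto
  have v: "v i \<in> carrier ?N" if "i < 6" for i
    using less_6[OF that] x by (auto simp: v_simps N.prod_closed)
  have sub: "submodule (lin_span ?N (v ` {..<6})) scalars ?N"
    using v by (intro N.lin_span_submodule) auto
  have mem: "v i \<in> lin_span ?N (v ` {..<6})" if "i < 6" for i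
    by (rule subsetD[OF N.lin_span_superset]) (use that in simp)
  define B :: "(nat \<Rightarrow> 'k) \<Rightarrow> (nat \<Rightarrow> 'k) \<Rightarrow> 'k" where
    "B f g = f 0 * g 3 + f 1 * g 4 + f 2 * g 5 + f 3 * g 0 + f 4 * g 1 + f 5 * g 2" for f g
  have "ad_invariant_metric ?N (\<lambda>x y. B (h x) (h y))"
  proof (rule N.metric_of_coordinates[where v = v and n = 6 and B = B, OF h(1) generates_fmn])
    show "?x ` {..<3} \<subseteq> v ` {..<6}"
    proof
      fix g assume "g \<in> ?x ` {..<3}"
      then obtain i where i: "g = ?x i" "i < 3" by blast
      then have "i = 0 \<or> i = 1 \<or> i = 2" by auto
      then have "g = v i" using i by (auto simp: v_simps)
      then show "g \<in> v ` {..<6}" using i by simp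
    qed
  next
    fix i j :: nat assume ij: "i < j" "j < 6"
    show "v i \<otimes>\<^bsub>?N\<^esub> v j \<in> lin_span ?N (v ` {..<6})"
    proof (cases "j \<le> 2")
      case True
      then consider "i = 0" "j = 1" | "i = 0" "j = 2" | "i = 1" "j = 2" using ij by force
      then show ?thesis
      proof cases
        case 2
        \<comment> \<open>The basis contains \<open>[x_2, x_0]\<close>, so the product
          \<open>[x_0, x_2]\<close> needs a sign.\<close>
        have "(-1) \<odot>\<^bsub>?N\<^esub> v 4 \<in> lin_span ?N (v ` {..<6})" using sub mem[of 4] by (simp add: N.submodule_iff)
        then show ?thesis using 2 N.skew[of "?x 0" "?x 2"] x by (simp add: v_simps)
      qed (use mem[of 3] mem[of 5] in \<open>simp_all add: v_simps\<close>)
    next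
      case False
      then have "j = 3 \<or> j = 4 \<or> j = 5" using ij by auto
      then have "v i \<otimes>\<^bsub>?N\<^esub> v j = \<zero>\<^bsub>?N\<^esub>" using x v[of i] ij by (auto simp: v_simps fmn_nilpotent_2)
      then show ?thesis using sub by (simp add: N.submodule_iff)
    qed
  next
    fix i :: nat assume "i < 6"
    from less_6[OF this] show "h (v i) = unit_vec i"
      using x by (auto simp: v_simps h(2) coord_homD(3)[OF h(1)] cross_bracket_def fun_eq_iff)
  next
    fix f :: "nat \<Rightarrow> 'k" and i :: nat
    assume orth: "\<And>j. j < 6 \<Longrightarrow> B f (unit_vec j) = 0" and i: "i < 6"
    from less_6[OF i] show "f i = 0"
      using orth[of 0] orth[of 1] orth[of 2] orth[of 3] orth[of 4] orth[of 5] by (auto simp: B_def)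
  qed (use v in \<open>auto simp: B_def cross_bracket_def algebra_simps\<close>)
  then show ?thesis by blast
qed

text \<open>
  Coordinates with respect to \<open>x\<^sub>0, x\<^sub>1, y = [x\<^sub>0, x\<^sub>1], [x\<^sub>0, y], [x\<^sub>1, y]\<close>.
\<close>

definition free_two_bracket :: "(nat \<Rightarrow> 'k::field) \<Rightarrow> (nat \<Rightarrow> 'k) \<Rightarrow> nat \<Rightarrow> 'k" where
  "free_two_bracket f g = (\<lambda>n. if n = 2 then f 0 * g 1 - f 1 * g 0 else
     if n = 3 then f 0 * g 2 - f 2 * g 0 else if n = 4 then f 1 * g 2 - f 2 * g 1 else 0)"

text \<open>Every term of the bracket contains coordinate 0 or 1, which gives the metabelian law. In
  coordinates 3 and 4 the Jacobi sum is a determinant with a repeated row.\<close>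

lemma graded_bracket_free_two:
  "graded_bracket (free_two_bracket :: (nat \<Rightarrow> 'k::field) \<Rightarrow> _)
     (\<lambda>n. if n = 2 then 2 else if n \<in> {3, 4} then 3 else 1) 3"
proof
  fix f g :: "nat \<Rightarrow> 'k" and r n :: nat
  assume g: "\<And>n. (if n = 2 then 2 else if n \<in> {3, 4} then 3 else 1) \<le> r \<Longrightarrow> g n = 0"
    and n: "(if n = 2 then 2 else if n \<in> {3, 4} then 3 else 1) \<le> Suc r"
  then show "free_two_bracket f g n = 0"
    using g[of 0] g[of 1] g[of 2] by (auto simp: free_two_bracket_def split: if_splits)
next
  fix f g :: "nat \<Rightarrow> 'k"
  assume f: "\<And>n. (if n = 2 then 2 else if n \<in> {3, 4} then 3 else 1) \<le> (1::nat) \<Longrightarrow> f n = 0"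
    and g: "\<And>n. (if n = 2 then 2 else if n \<in> {3, 4} then 3 else 1) \<le> (1::nat) \<Longrightarrow> g n = 0"
  show "free_two_bracket f g = (\<lambda>n. 0)"
    using f[of 0] f[of 1] g[of 0] g[of 1] by (auto simp: free_two_bracket_def)
qed (auto simp: free_two_bracket_def algebra_simps)

lemma fmn_metric_2_3:
  "\<exists>form. ad_invariant_metric
     (free_metabelian_nilpotent 2 3 :: ('k::field, (nat magma \<Rightarrow> 'k) set set) module) form"
proof -
  let ?N = "free_metabelian_nilpotent 2 3 :: ('k, (nat magma \<Rightarrow> 'k) set set) module"
  let ?x = "fmn_gen 2 3 :: nat \<Rightarrow> (nat magma \<Rightarrow> 'k) set set"
  let ?y = "?x 0 \<otimes>\<^bsub>?N\<^esub> ?x 1"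
  interpret N: lie_algebra ?N by (rule lie_algebra_free_metabelian_nilpotent)
  interpret graded_bracket "free_two_bracket :: (nat \<Rightarrow> 'k) \<Rightarrow> _"
      "\<lambda>n. if n = 2 then 2 else if n \<in> {3, 4} then 3 else 1" 3
    by (rule graded_bracket_free_two)
  obtain h where h: "coord_hom ?N free_two_bracket h" "\<And>i. i < 2 \<Longrightarrow> h (?x i) = unit_vec i"
    using coord_hom_fmn[where m = 2 and g = unit_vec] by blast
  have x: "?x 0 \<in> carrier ?N" "?x 1 \<in> carrier ?N" "?y \<in> carrier ?N"
    by (simp_all add: fmn_gen_closed N.prod_closed)
  define v where "v i = [?x 0, ?x 1, ?y, ?x 0 \<otimes>\<^bsub>?N\<^esub> ?y, ?x 1 \<otimes>\<^bsub>?N\<^esub> ?y] ! i" for i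
  have v_simps: "v 0 = ?x 0" "v 1 = ?x 1" "v (Suc 0) = ?x 1" "v 2 = ?y" "v 3 = ?x 0 \<otimes>\<^bsub>?N\<^esub> ?y" "v 4 = ?x 1 \<otimes>\<^bsub>?N\<^esub> ?y"
    by (simp_all add: v_def)
  have less_5: "i = 0 \<or> i = 1 \<or> i = 2 \<or> i = 3 \<or> i = 4" if "i < 5" for i :: nat
    using that by auto
  have v: "v i \<in> carrier ?N" if "i < 5" for i
    using less_5[OF that] x by (auto simp: v_simps N.prod_closed)
  have sub: "submodule (lin_span ?N (v ` {..<5})) scalars ?N"
    using v by (intro N.lin_span_submodule) auto
  have mem: "v i \<in> lin_span ?N (v ` {..<5})" if "i < 5" for i
    by (rule subsetD[OF N.lin_span_superset]) (use that in simp)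
  have hy: "h ?y = unit_vec 2"
    using coord_homD(3)[OF h(1) x(1,2)] by (auto simp: h(2) free_two_bracket_def)
  \<comment> \<open>Normalizing \<open>\<langle>y, y\<rangle> = 1\<close>, invariance forces
    \<open>\<langle>x_0, [x_1, y]\<rangle> = \<langle>[x_0, x_1], y\<rangle> = 1\<close> and
    \<open>\<langle>x_1, [x_0, y]\<rangle> = \<langle>[x_1, x_0], y\<rangle> = -1\<close>.\<close>
  define B :: "(nat \<Rightarrow> 'k) \<Rightarrow> (nat \<Rightarrow> 'k) \<Rightarrow> 'k" where
    "B f g = f 0 * g 4 + f 4 * g 0 - f 1 * g 3 - f 3 * g 1 + f 2 * g 2" for f g
  have "ad_invariant_metric ?N (\<lambda>x y. B (h x) (h y))"
  proof (rule N.metric_of_coordinates[where v = v and n = 5 and B = B, OF h(1) generates_fmn])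
    show "?x ` {..<2} \<subseteq> v ` {..<5}"
    proof
      fix g assume "g \<in> ?x ` {..<2}"
      then obtain i where i: "g = ?x i" "i < 2" by blast
      then have "i = 0 \<or> i = 1" by auto
      then have "g = v i" using i by (auto simp: v_simps)
      then show "g \<in> v ` {..<5}" using i by simp
    qed
  next
    fix i j :: nat assume ij: "i < j" "j < 5"
    show "v i \<otimes>\<^bsub>?N\<^esub> v j \<in> lin_span ?N (v ` {..<5})"
    proof (cases "j \<le> 2")
      case True
      then consider "i = 0" "j = 1" | "i = 0" "j = 2" | "i = 1" "j = 2" using ij by force
      then show ?thesis by cases (use mem[of 2] mem[of 3] mem[of 4] in \<open>simp_all add: v_simps\<close>)
    next
      case False
      then have "j = 3 \<or> j = 4" using ij by auto
      \<comment> \<open>Here \<open>v j\<close> is a threefold bracket, so the product lies in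
        \<open>C^3\<close>, which is zero.\<close>
      then have "v i \<otimes>\<^bsub>?N\<^esub> v j = \<zero>\<^bsub>?N\<^esub>" using x v[of i] ij by (auto simp: v_simps fmn_nilpotent_3)
      then show ?thesis using sub by (simp add: N.submodule_iff)
    qed
  next
    fix i :: nat assume "i < 5"
    from less_5[OF this] show "h (v i) = unit_vec i"
      using x by (auto simp: v_simps h(2) hy coord_homD(3)[OF h(1)] free_two_bracket_def fun_eq_iff)
  next
    fix f :: "nat \<Rightarrow> 'k" and i :: nat
    assume orth: "\<And>j. j < 5 \<Longrightarrow> B f (unit_vec j) = 0" and i: "i < 5"
    from less_5[OF i] show "f i = 0"
      using orth[of 0] orth[of 1] orth[of 2] orth[of 3] orth[of 4] by (auto simp: B_def)
  qed (use v in \<open>auto simp: B_def free_two_bracket_def algebra_simps\<close>)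
  then show ?thesis by blast
qed

theorem theorem3p9:
  fixes m k :: nat
  assumes "m \<ge> 2" and "k \<ge> 2"
  shows "(\<exists>form. ad_invariant_metric
            (free_metabelian_nilpotent m k ::
               ('k::field_char_0, (nat magma \<Rightarrow> 'k) set set) module) form)
         \<longleftrightarrow> (m, k) = (3, 2) \<or> (m, k) = (2, 3)"
  using fmn_metric_necessary[OF assms] fmn_metric_3_2 fmn_metric_2_3 by auto

end
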